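(* Let $n$ be a natural number ($n\ge 1$), and let $F=\{F_{\tau\sigma}\}_{\tau,\sigma\in\mathbb{R}}$ be a system of functions such that, for each $\tau,\sigma\in\mathbb{R}$, the domain $\mathrm{Dom}(F_{\tau\sigma})$ and the codomain $\mathrm{Codom}(F_{\tau\sigma})$ are (possibly empty) subsets of $\mathbb{R}^n$. Then the following two assertions are equivalent. (A) There exists a $C^1$-mapping $f$, whose domain $\mathrm{Dom}(f)$ is a non-empty open subset of $\mathbb{R}\times\mathbb{R}^n$ and whose codomain is $\mathbb{R}^n$, such that $F$ is the system of coordinates transformations of the Cauchy atlas on the set $M$ of all complete solutions of the differential equation $\dot{x}=f(\tau,x)$. (B) All of the following conditions hold: 1. the set $K=\{(\tau,\rho,a)\in\mathbb{R}\times\mathbb{R}\times\mathbb{R}^n \mid a\in\mathrm{Dom}(F_{\tau\rho})\}$ is a non-empty open set; 2. each function $F_{\tau\rho}\colon \mathrm{Dom}(F_{\tau\rho})\to\mathrm{Codom}(F_{\tau\rho})$ from $F$ is a bijection; 3. the mapping $K\ni(\tau,\rho,a)\mapsto \partial F_{\tau\rho}(a)/\partial\tau\in\mathbb{R}^n$ is (well defined and) $C^1$; 4. for each $\rho\in\mathbb{R}$ and $a\in\mathbb{R}^n$, the set $J(\rho,a)=\{\tau\in\mathbb{R}\mid a\in\mathrm{Dom}(F_{\tau\rho})\}$ is an open interval (possibly empty or unbounded); 5. for each $\tau,\sigma,\rho\in\mathbb{R}$ and for each $a\in F_{\sigma\rho}^{-1}\bigl(\mathrm{Codom}(F_{\sigma\rho})\cap\mathrm{Codom}(F_{\sigma\tau})\bigr)$,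 $$F_{\tau\sigma}(F_{\sigma\rho}(a))=F_{\tau\rho}(a),$$ where the equality includes the assertion that both sides are defined, i.e. $F_{\sigma\rho}(a)\in\mathrm{Dom}(F_{\tau\sigma})$ and $a\in\mathrm{Dom}(F_{\tau\rho})$.
   Context: Functions carry a specified domain and codomain; the empty mapping (empty domain and codomain) is admitted. Let $f$ be a $C^1$-mapping, where $\mathrm{Dom}(f)$ is a non-empty open subset of $\mathbb{R}\times\mathbb{R}^n$ and $\mathrm{Codom}(f)=\mathbb{R}^n$. Consider the first-order ordinary differential equation $\dot{x}=f(\tau,x)$. A complete solution is a maximal (non-extendable) solution: a differentiable map $x$ from an open non-empty interval $\mathrm{Dom}(x)\subseteq\mathbb{R}$ to $\mathbb{R}^n$ with $(\tau,x(\tau))\in\mathrm{Dom}(f)$ and $\dot{x}(\tau)=f(\tau,x(\tau))$ for all $\tau\in\mathrm{Dom}(x)$, which is not a proper restriction of another such solution. Let $M$ be the set of all complete solutions of this equation. For each $\tau\in\mathbb{R}$ define the mapping $\varphi_\tau$ with $$\mathrm{Dom}(\varphi_\tau)=\{x\in M\mid \tau\in\mathrm{Dom}(x)\},\qquad \mathrm{Codom}(\varphi_\tau)=\{a\in\mathbb{R}^n\mid(\tau,a)\in\mathrm{Dom}(f)\},\qquad \varphi_\tau(x)=x(\tau).$$ By existence and uniqueness of the complete solution through each initial condition $x(\rho)=a$, $(\rho,a)\in\mathrm{Dom}(f)$, each $\varphi_\tau$ is a bijection (a coordinates chart on $M$). The system $\{\varphi_\tau\}_{\tau\in\mathbb{R}}$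 is called the Cauchy atlas on $M$. The coordinates transformations of the Cauchy atlas are the mappings, for $\tau,\rho\in\mathbb{R}$, $$\varphi_\rho\bigl(\mathrm{Dom}(\varphi_\tau)\cap\mathrm{Dom}(\varphi_\rho)\bigr)\ni a\mapsto \varphi_\tau(\varphi_\rho^{-1}(a))\in\varphi_\tau\bigl(\mathrm{Dom}(\varphi_\tau)\cap\mathrm{Dom}(\varphi_\rho)\bigr),$$ with exactly the indicated domain and codomain (possibly empty). Saying that $F=\{F_{\tau\rho}\}$ is the system of coordinates transformations of the Cauchy atlas means that for every $\tau,\rho\in\mathbb{R}$ the function $F_{\tau\rho}$ equals this mapping, including its domain and codomain. *)

theory Defs
  imports "HOL-Analysis.Analysis"
begin

text \<open>
  Functions carrying a domain and a codomain.  The values are extensional (\<^term>\<open>undefined\<close> off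
  the domain), so equality of elements of this type is equality of domain, codomain and all values.
\<close>

typedef ('a, 'b) func = "{(D :: 'a set, C :: 'b set, f). f \<in> D \<rightarrow>\<^sub>E C}"
  by (rule exI[of _ "({}, {}, \<lambda>_. undefined)"]) simp

definition Dom :: "('a, 'b) func \<Rightarrow> 'a set"
  where "Dom F = fst (Rep_func F)"

definition Codom :: "('a, 'b) func \<Rightarrow> 'b set"
  where "Codom F = fst (snd (Rep_func F))"

definition app :: "('a, 'b) func \<Rightarrow> 'a \<Rightarrow> 'b"
  where "app F = snd (snd (Rep_func F))"

text \<open>Only meaningful when \<^term>\<open>f\<close> maps \<^term>\<open>D\<close> into \<^term>\<open>C\<close>.\<close>

definition mk_func :: "'a set \<Rightarrow> 'b set \<Rightarrow> ('a \<Rightarrow> 'b) \<Rightarrow> ('a, 'b) func"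
  where "mk_func D C f = Abs_func (D, C, restrict f D)"

lemma app_extensional_funcset: "app F \<in> Dom F \<rightarrow>\<^sub>E Codom F"
  using Rep_func[of F] by (auto simp: Dom_def Codom_def app_def)

lemma func_eq_iff:
  "F = G \<longleftrightarrow> Dom F = Dom G \<and> Codom F = Codom G \<and> (\<forall>a\<in>Dom F. app F a = app G a)"
proof
  assume *: "Dom F = Dom G \<and> Codom F = Codom G \<and> (\<forall>a\<in>Dom F. app F a = app G a)"
  then have "app F = app G"
    using app_extensional_funcset[of F] app_extensional_funcset[of G]
    by (intro PiE_ext[of _ "Dom F" "\<lambda>_. Codom F"]) auto
  with * have "Rep_func F = Rep_func G"
    by (simp add: Dom_def Codom_def app_def prod_eq_iff)
  then show "F = G"
    by (simp add: Rep_func_inject)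
qed simp

lemma mk_func_sel:
  assumes "f \<in> D \<rightarrow> C"
  shows "Dom (mk_func D C f) = D"
    and "Codom (mk_func D C f) = C"
    and "a \<in> D \<Longrightarrow> app (mk_func D C f) a = f a"
proof -
  have "Rep_func (mk_func D C f) = (D, C, restrict f D)"
    unfolding mk_func_def using assms by (intro Abs_func_inverse) auto
  then show "Dom (mk_func D C f) = D" "Codom (mk_func D C f) = C"
    "a \<in> D \<Longrightarrow> app (mk_func D C f) a = f a"
    by (simp_all add: Dom_def Codom_def app_def)
qed

definition is_bijection :: "('a, 'b) func \<Rightarrow> bool"
  where "is_bijection F \<longleftrightarrow> bij_betw (app F) (Dom F) (Codom F)"

definition restriction_of :: "('a, 'b) func \<Rightarrow> ('a, 'b) func \<Rightarrow> bool"
  where "restriction_of F G \<longleftrightarrow>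
    Dom F \<subseteq> Dom G \<and> Codom F = Codom G \<and> (\<forall>a\<in>Dom F. app F a = app G a)"

text \<open>Intended for open \<^term>\<open>U\<close>.\<close>

definition C1_on :: "('a :: real_normed_vector \<Rightarrow> 'b :: real_normed_vector) \<Rightarrow> 'a set \<Rightarrow> bool"
  where "C1_on f U \<longleftrightarrow>
    (\<exists>f' :: 'a \<Rightarrow> 'a \<Rightarrow>\<^sub>L 'b.
       (\<forall>x\<in>U. (f has_derivative blinfun_apply (f' x)) (at x)) \<and> continuous_on U f')"

definition open_interval :: "real set \<Rightarrow> bool"
  where "open_interval J \<longleftrightarrow> open J \<and> is_interval J"

type_synonym 'n vector_field = "(real \<times> (real ^ 'n), real ^ 'n) func"
type_synonym 'n curve = "(real, real ^ 'n) func"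

definition is_solution :: "'n::finite vector_field \<Rightarrow> 'n curve \<Rightarrow> bool"
  where "is_solution f x \<longleftrightarrow>
    open_interval (Dom x) \<and> Dom x \<noteq> {} \<and> Codom x = UNIV \<and>
    (\<forall>\<tau>\<in>Dom x. (\<tau>, app x \<tau>) \<in> Dom f \<and>
       (app x has_vector_derivative app f (\<tau>, app x \<tau>)) (at \<tau>))"

definition complete_solutions :: "'n::finite vector_field \<Rightarrow> 'n curve set"
  where "complete_solutions f =
    {x. is_solution f x \<and> \<not> (\<exists>y. is_solution f y \<and> restriction_of x y \<and> x \<noteq> y)}"

definition cauchy_chart :: "'n::finite vector_field \<Rightarrow> real \<Rightarrow> ('n curve, real ^ 'n) func"
  where "cauchy_chart f \<tau> =
    mk_func {x \<in> complete_solutions f. \<tau> \<in> Dom x} {a. (\<tau>, a) \<in> Dom f} (\<lambda>x. app x \<tau>)"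

definition coordinates_transformation ::
    "('m, 'a) func \<Rightarrow> ('m, 'a) func \<Rightarrow> ('a, 'a) func"
  where "coordinates_transformation \<phi> \<psi> =
    mk_func (app \<psi> ` (Dom \<phi> \<inter> Dom \<psi>)) (app \<phi> ` (Dom \<phi> \<inter> Dom \<psi>))
      (\<lambda>a. app \<phi> (the_inv_into (Dom \<psi>) (app \<psi>) a))"

definition cauchy_transformations ::
    "'n::finite vector_field \<Rightarrow> real \<Rightarrow> real \<Rightarrow> (real ^ 'n, real ^ 'n) func"
  where "cauchy_transformations f \<tau> \<rho> =
    coordinates_transformation (cauchy_chart f \<tau>) (cauchy_chart f \<rho>)"

definition total_domain ::
    "(real \<Rightarrow> real \<Rightarrow> (real ^ 'n::finite, real ^ 'n) func) \<Rightarrow> (real \<times> real \<times> (real ^ 'n)) set"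
  where "total_domain F = {(\<tau>, \<rho>, a). a \<in> Dom (F \<tau> \<rho>)}"

text \<open>
  The partial derivative in the first index.  When the total domain is open, the curve
  \<open>s \<mapsto> F\<^sub>s\<^sub>\<rho>(a)\<close> is defined near each \<open>\<tau>\<close> considered, so its values off the domain do not matter.
\<close>

definition tau_derivative ::
    "(real \<Rightarrow> real \<Rightarrow> (real ^ 'n::finite, real ^ 'n) func) \<Rightarrow> real \<times> real \<times> (real ^ 'n) \<Rightarrow> real ^ 'n"
  where "tau_derivative F = (\<lambda>(\<tau>, \<rho>, a). vector_derivative (\<lambda>s. app (F s \<rho>) a) (at \<tau>))"

end

theory Submission
  imports Defs
begin

text \<open>
  \<^item> From the equation to the conditions.  Write \<open>x\<close> for the complete solution with \<open>x(\<rho>) = a\<close>.  Then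
  \<open>F\<^sub>\<tau>\<^sub>\<rho>(a) = x(\<tau>)\<close>, defined exactly for \<open>\<tau>\<close> in the domain of \<open>x\<close>, and uniqueness of complete
  solutions makes each \<open>F\<^sub>\<tau>\<^sub>\<rho>\<close> a bijection, makes \<open>J(\<rho>, a)\<close> an interval and gives the cocycle
  condition.  Since \<open>\<partial>F\<^sub>\<tau>\<^sub>\<rho>(a)/\<partial>\<tau> = f(\<tau>, F\<^sub>\<tau>\<^sub>\<rho>(a))\<close>, the remaining conditions amount to the classical theorem
  that the global flow has an open domain and is \<open>C\<^sup>1\<close> jointly in \<open>(\<tau>, \<rho>, a)\<close>
  (\<open>flow_regular\<close>).

  \<^item> The flow theorem.  On a short time interval the Picard iterates of the autonomous field
  \<open>(1, f)\<close> on space-time, together with their derivatives in the initial point, converge uniformly;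
  this yields existence of solutions and \<open>C\<^sup>1\<close> dependence at once (\<open>C1_local_flow\<close>).  Regularity is
  then carried along a complete solution by composing with local flows; the set of times up to
  which this works is open and closed in the domain of the solution (\<open>regular_everywhere\<close>).

  \<^item> From the conditions to the equation.  The field can only be the velocity on the diagonal,
  \<open>f(\<tau>, a) = \<partial>F\<^sub>s\<^sub>\<tau>(a)/\<partial>s\<close> at \<open>s = \<tau>\<close>.  The cocycle condition and injectivity give \<open>F\<^sub>\<tau>\<^sub>\<tau> = id\<close> and
  \<open>Codom F\<^sub>\<sigma>\<^sub>\<rho> = Dom F\<^sub>\<rho>\<^sub>\<sigma>\<close>, so every orbit \<open>\<tau> \<mapsto> F\<^sub>\<tau>\<^sub>\<rho>(a)\<close> solves the equation (\<open>orbit_solves\<close>).  No solution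
  extends it, because at an end point of \<open>J(\<rho>, a)\<close> the cocycle condition would put that point into
  \<open>J(\<rho>, a)\<close> (\<open>orbit_maximal\<close>).  Hence the orbits are the complete solutions.
\<close>


section \<open>Calculus of continuously differentiable maps\<close>

lemma C1_onD:
  assumes "C1_on f U"
  obtains f' where "\<And>x. x \<in> U \<Longrightarrow> (f has_derivative blinfun_apply (f' x)) (at x)"
    "continuous_on U f'"
  using assms unfolding C1_on_def by blast

lemma C1_onI:
  assumes "\<And>x. x \<in> U \<Longrightarrow> (f has_derivative blinfun_apply (f' x)) (at x)" "continuous_on U f'"
  shows "C1_on f U"
  using assms unfolding C1_on_def by blast

lemma C1_on_continuous_on: "C1_on f U \<Longrightarrow> continuous_on U f"
  by (meson C1_onD continuous_at_imp_continuous_on has_derivative_continuous)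

lemma C1_on_subset: "C1_on f U \<Longrightarrow> V \<subseteq> U \<Longrightarrow> C1_on f V"
  unfolding C1_on_def by (meson continuous_on_subset subsetD)

lemma C1_on_cong:
  assumes "C1_on f U" "open U" "\<And>x. x \<in> U \<Longrightarrow> g x = f x"
  shows "C1_on g U"
proof -
  obtain f' where f': "\<And>x. x \<in> U \<Longrightarrow> (f has_derivative blinfun_apply (f' x)) (at x)"
    "continuous_on U f'"
    using C1_onD[OF assms(1)] by blast
  show ?thesis
  proof (rule C1_onI[OF _ f'(2)])
    fix x assume "x \<in> U"
    then show "(g has_derivative blinfun_apply (f' x)) (at x)"
      using has_derivative_transform_within_open[OF f'(1) assms(2)] assms(3) by metis
  qed
qed

lemma C1_on_blinfun: "C1_on (blinfun_apply A) U"
  by (rule C1_onI[of _ _ "\<lambda>_. A"])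
    (auto intro!: bounded_linear_imp_has_derivative blinfun.bounded_linear_right)

lemma C1_on_bounded_linear: "bounded_linear h \<Longrightarrow> C1_on h U"
  by (metis C1_on_blinfun bounded_linear_Blinfun_apply)

lemma C1_on_const: "C1_on (\<lambda>_. c) U"
  by (rule C1_onI[of _ _ "\<lambda>_. 0"]) (simp_all add: zero_blinfun.rep_eq)

lemma C1_on_compose:
  assumes "C1_on g V" "C1_on f U" "f ` U \<subseteq> V"
  shows "C1_on (\<lambda>x. g (f x)) U"
proof -
  obtain f' where f': "\<And>x. x \<in> U \<Longrightarrow> (f has_derivative blinfun_apply (f' x)) (at x)"
    "continuous_on U f'"
    using C1_onD[OF assms(2)] by blast
  obtain g' where g': "\<And>x. x \<in> V \<Longrightarrow> (g has_derivative blinfun_apply (g' x)) (at x)"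
    "continuous_on V g'"
    using C1_onD[OF assms(1)] by blast
  show ?thesis
  proof (rule C1_onI)
    show "((\<lambda>x. g (f x)) has_derivative blinfun_apply (g' (f x) o\<^sub>L f' x)) (at x)" if "x \<in> U" for x
      using has_derivative_compose[OF f'(1)[OF that] g'(1)] that assms(3)
      by (auto simp: blinfun_compose.rep_eq o_def)
    show "continuous_on U (\<lambda>x. g' (f x) o\<^sub>L f' x)"
      by (intro continuous_intros f'(2) continuous_on_compose2[OF g'(2)]
          C1_on_continuous_on[OF assms(2)] assms(3))
  qed
qed

lift_definition blinfun_inl :: "'a::real_normed_vector \<Rightarrow>\<^sub>L ('a \<times> 'b::real_normed_vector)"
  is "\<lambda>x. (x, 0)"
  by (intro bounded_linear_Pair bounded_linear_ident bounded_linear_zero)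

lift_definition blinfun_inr :: "'b::real_normed_vector \<Rightarrow>\<^sub>L ('a::real_normed_vector \<times> 'b)"
  is "\<lambda>x. (0, x)"
  by (intro bounded_linear_Pair bounded_linear_ident bounded_linear_zero)

lemma C1_on_Pair:
  assumes "C1_on f U" "C1_on g U"
  shows "C1_on (\<lambda>x. (f x, g x)) U"
proof -
  obtain f' where f': "\<And>x. x \<in> U \<Longrightarrow> (f has_derivative blinfun_apply (f' x)) (at x)"
    "continuous_on U f'"
    using C1_onD[OF assms(1)] by blast
  obtain g' where g': "\<And>x. x \<in> U \<Longrightarrow> (g has_derivative blinfun_apply (g' x)) (at x)"
    "continuous_on U g'"
    using C1_onD[OF assms(2)] by blast
  show ?thesis
  proof (rule C1_onI)
    show "((\<lambda>x. (f x, g x)) has_derivative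
        blinfun_apply ((blinfun_inl o\<^sub>L f' x) + (blinfun_inr o\<^sub>L g' x))) (at x)" if "x \<in> U" for x
      by (rule has_derivative_eq_rhs[OF has_derivative_Pair[OF f'(1)[OF that] g'(1)[OF that]]])
        (auto simp add: blinfun.add_left blinfun_inl.rep_eq blinfun_inr.rep_eq)
    show "continuous_on U (\<lambda>x. (blinfun_inl o\<^sub>L f' x) + (blinfun_inr o\<^sub>L g' x))"
      by (intro continuous_intros f' g')
  qed
qed

text \<open>
  The local derivatives fit together because the derivative at a point is unique.
\<close>

lemma C1_on_local:
  assumes "\<And>x. x \<in> U \<Longrightarrow> \<exists>V. open V \<and> x \<in> V \<and> C1_on f V"
  shows "C1_on f U"
proof (rule C1_onI)
  let ?D = "\<lambda>x. Blinfun (frechet_derivative f (at x))"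
  have D: "(f has_derivative blinfun_apply (?D x)) (at x) \<and> isCont ?D x" if "x \<in> U" for x
  proof -
    obtain V where V: "open V" "x \<in> V" "C1_on f V"
      using assms[OF \<open>x \<in> U\<close>] by blast
    obtain f' where f': "\<And>x. x \<in> V \<Longrightarrow> (f has_derivative blinfun_apply (f' x)) (at x)"
      "continuous_on V f'"
      using C1_onD[OF V(3)] by blast
    have eq: "?D y = f' y" if "y \<in> V" for y
      using frechet_derivative_at[OF f'(1)[OF that]] by (metis blinfun_apply_inverse)
    then have "isCont ?D x = isCont f' x"
      using V by (intro isCont_cong eventually_nhds_in_open[THEN eventually_mono]) auto
    then show ?thesis
      using eq V f' by (metis continuous_on_eq_continuous_at)
  qed
  show "(f has_derivative blinfun_apply (?D x)) (at x)" if "x \<in> U" for x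
    using D[OF that] by blast
  show "continuous_on U ?D"
    using D by (simp add: continuous_at_imp_continuous_on)
qed

section \<open>The local flow of a continuously differentiable vector field\<close>

lemma norm_integral_diff_le:
  fixes u v :: "real \<Rightarrow> 'b::banach"
  assumes "continuous_on {0..1} u" "continuous_on {0..1} v"
    and "\<And>s. s \<in> {0..1} \<Longrightarrow> norm (u s - v s) \<le> e"
  shows "norm (integral {0..1} u - integral {0..1} v) \<le> e"
proof -
  have "u integrable_on {0..1}" "v integrable_on {0..1}"
    using assms by (auto intro: integrable_continuous_interval)
  then have "integral {0..1} u - integral {0..1} v = integral {0..1} (\<lambda>s. u s - v s)"
    by (simp add: Henstock_Kurzweil_Integration.integral_diff)
  also have "norm \<dots> \<le> e * (1 - 0)"
    by (intro integral_bound continuous_intros assms) auto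
  finally show ?thesis by simp
qed

text \<open>
  A geometric contraction estimate up to an error that may be made arbitrarily small still
  forces uniform convergence; this is the form in which the derivatives of the Picard iterates
  are controlled, where the error comes from the modulus of continuity of the derivative of the
  vector field.  The factor \<open>3/4\<close> leaves room for such an error on top of a contraction by \<open>1/2\<close>.
\<close>

lemma uniform_limit_of_contraction:
  fixes u :: "nat \<Rightarrow> 'b \<Rightarrow> 'c::banach"
  assumes start: "\<And>j k x. x \<in> S \<Longrightarrow> dist (u j x) (u k x) \<le> c"
    and step: "\<And>e N. e > 0 \<Longrightarrow> (\<And>j k x. N \<le> j \<Longrightarrow> N \<le> k \<Longrightarrow> x \<in> S \<Longrightarrow> dist (u j x) (u k x) \<le> e) \<Longrightarrow>
      \<exists>N'. \<forall>j\<ge>N'. \<forall>k\<ge>N'. \<forall>x\<in>S. dist (u j x) (u k x) \<le> 3/4 * e"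
  obtains l where "uniform_limit S u l sequentially"
proof -
  define E where "E = max c 1"
  have E: "E > 0" "c \<le> E"
    by (auto simp: E_def)
  have *: "\<exists>N. \<forall>j\<ge>N. \<forall>k\<ge>N. \<forall>x\<in>S. dist (u j x) (u k x) \<le> (3/4)^m * E" for m
  proof (induction m)
    case 0
    show ?case using order_trans[OF start E(2)] by auto
  next
    case (Suc m)
    then obtain N where "\<forall>j\<ge>N. \<forall>k\<ge>N. \<forall>x\<in>S. dist (u j x) (u k x) \<le> (3/4)^m * E"
      by blast
    then have "\<exists>N'. \<forall>j\<ge>N'. \<forall>k\<ge>N'. \<forall>x\<in>S. dist (u j x) (u k x) \<le> 3/4 * ((3/4)^m * E)"
      using E by (intro step) auto
    then show ?case by (simp only: power_Suc mult.assoc)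
  qed
  have "uniformly_Cauchy_on S u"
  proof (rule uniformly_Cauchy_onI)
    fix e :: real assume "e > 0"
    obtain m where "(3/4 :: real)^m < e / E"
      using real_arch_pow_inv[of "e / E" "3/4"] \<open>e > 0\<close> E by auto
    then have "(3/4)^m * E < e"
      using E by (simp add: field_simps)
    then show "\<exists>M. \<forall>x\<in>S. \<forall>j\<ge>M. \<forall>k\<ge>M. dist (u j x) (u k x) < e"
      using *[of m] by (blast intro: order_le_less_trans)
  qed
  then show ?thesis
    using that uniformly_convergent_eq_Cauchy[of S u]
    unfolding uniformly_convergent_on_def by blast
qed

text \<open>
  The usual integral from \<open>0\<close> to \<open>t\<close> is rescaled to the unit interval: this treats negative times
  without signed integrals, and a fixed interval of integration allows differentiation under the
  integral sign.
\<close>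

primrec picard_iter :: "('a::euclidean_space \<Rightarrow> 'a) \<Rightarrow> nat \<Rightarrow> real \<Rightarrow> 'a \<Rightarrow> 'a" where
  "picard_iter g 0 t z = z"
| "picard_iter g (Suc k) t z = z + t *\<^sub>R integral {0..1} (\<lambda>s. g (picard_iter g k (t * s) z))"

text \<open>
  This is what the chain rule gives for the derivative of the iterate with respect to \<open>z\<close>, if
  \<open>g'\<close> is the derivative of \<open>g\<close>.
\<close>

primrec picard_deriv ::
    "('a::euclidean_space \<Rightarrow> 'a) \<Rightarrow> ('a \<Rightarrow> 'a \<Rightarrow>\<^sub>L 'a) \<Rightarrow> nat \<Rightarrow> real \<Rightarrow> 'a \<Rightarrow> 'a \<Rightarrow>\<^sub>L 'a" where
  "picard_deriv g g' 0 t z = id_blinfun"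
| "picard_deriv g g' (Suc k) t z = id_blinfun +
     t *\<^sub>R integral {0..1} (\<lambda>s. g' (picard_iter g k (t * s) z) o\<^sub>L picard_deriv g g' k (t * s) z)"

text \<open>
  The time bound \<open>\<delta>\<close> is small enough for two purposes: with \<open>\<delta> * M \<le> r\<close> the iterates that start in the
  ball of radius \<open>r\<close> stay in the ball of radius \<open>2 * r\<close>, where the bounds hold, and with
  \<open>\<delta> * L \<le> 1/2\<close> the Picard operator halves distances.
\<close>

locale picard_ball =
  fixes g :: "'a::euclidean_space \<Rightarrow> 'a" and g' :: "'a \<Rightarrow> 'a \<Rightarrow>\<^sub>L 'a"
    and z0 :: 'a and r \<delta> M L :: real
  assumes r_pos: "r > 0" and \<delta>_pos: "\<delta> > 0"
    and deriv: "\<And>x. x \<in> cball z0 (2 * r) \<Longrightarrow> (g has_derivative blinfun_apply (g' x)) (at x)"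
    and cont': "continuous_on (cball z0 (2 * r)) g'"
    and bound: "\<And>x. x \<in> cball z0 (2 * r) \<Longrightarrow> norm (g x) \<le> M"
    and bound': "\<And>x. x \<in> cball z0 (2 * r) \<Longrightarrow> norm (g' x) \<le> L"
    and small: "\<delta> * M \<le> r" and small': "\<delta> * L \<le> 1/2"
begin

abbreviation "T \<equiv> {-\<delta>..\<delta>}"
abbreviation "B \<equiv> ball z0 r"
abbreviation "C \<equiv> cball z0 (2 * r)"
abbreviation "\<phi> \<equiv> picard_iter g"
abbreviation "A \<equiv> picard_deriv g g'"

lemma cont: "continuous_on C g"
  using deriv by (meson continuous_at_imp_continuous_on has_derivative_continuous)

lemma L_nonneg: "L \<ge> 0"
  using order_trans[OF norm_ge_zero bound'[of z0]] r_pos by simp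

lemma lipschitz: "x \<in> C \<Longrightarrow> y \<in> C \<Longrightarrow> norm (g x - g y) \<le> L * norm (x - y)"
  by (rule differentiable_bound[where S=C and f'="\<lambda>x. blinfun_apply (g' x)"])
    (use deriv bound' in \<open>auto intro: has_derivative_at_withinI simp: norm_blinfun.rep_eq\<close>)

lemma scale_T: "t \<in> T \<Longrightarrow> s \<in> {0..1} \<Longrightarrow> t * s \<in> T"
proof -
  assume "t \<in> T" "s \<in> {0..1}"
  then have "\<bar>t * s\<bar> \<le> \<delta> * 1"
    unfolding abs_mult by (intro mult_mono) auto
  then show ?thesis by auto
qed

lemma scaled_le:
  assumes "t \<in> T" "norm x \<le> e"
  shows "norm (t *\<^sub>R x) \<le> \<delta> * e"
  using assms unfolding norm_scaleR by (intro mult_mono) auto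

lemma scaled_continuous:
  fixes u :: "real \<Rightarrow> 'a \<Rightarrow> 'b::topological_space"
  assumes "continuous_on (T \<times> B) (\<lambda>(t, z). u t z)"
  shows "continuous_on ((T \<times> B) \<times> cbox 0 1) (\<lambda>(w, s). u (fst w * s) (snd w))"
    and "t \<in> T \<Longrightarrow> z \<in> B \<Longrightarrow> continuous_on {0..1} (\<lambda>s. u (t * s) z)"
    and "t \<in> T \<Longrightarrow> continuous_on (B \<times> cbox 0 1) (\<lambda>(z, s). u (t * s) z)"
proof -
  have u: "continuous_on X (\<lambda>x. u (p x) (q x))"
    if "continuous_on X p" "continuous_on X q" "\<And>x. x \<in> X \<Longrightarrow> p x \<in> T" "\<And>x. x \<in> X \<Longrightarrow> q x \<in> B"
    for X :: "'d::topological_space set" and p q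
  proof -
    have "(\<lambda>x. (p x, q x)) ` X \<subseteq> T \<times> B"
      using that by blast
    with continuous_on_compose2[OF assms continuous_on_Pair[OF that(1,2)]] show ?thesis
      by simp
  qed
  show "continuous_on ((T \<times> B) \<times> cbox 0 1) (\<lambda>(w, s). u (fst w * s) (snd w))"
    unfolding split_beta using scale_T by (intro u continuous_intros) auto
  show "t \<in> T \<Longrightarrow> z \<in> B \<Longrightarrow> continuous_on {0..1} (\<lambda>s. u (t * s) z)"
    using scale_T by (intro u continuous_intros) auto
  show "t \<in> T \<Longrightarrow> continuous_on (B \<times> cbox 0 1) (\<lambda>(z, s). u (t * s) z)"
    unfolding split_beta using scale_T by (intro u continuous_intros) auto
qed

lemma scaled_integral_continuous:
  fixes u :: "real \<Rightarrow> 'a \<Rightarrow> 'b::banach"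
  assumes "continuous_on (T \<times> B) (\<lambda>(t, z). u t z)"
  shows "continuous_on (T \<times> B) (\<lambda>(t, z). t *\<^sub>R integral {0..1} (\<lambda>s. u (t * s) z))"
  using integral_continuous_on_param[OF scaled_continuous(1)[OF assms]]
  by (auto simp: split_beta intro!: continuous_intros)

lemma iter_in_C: "t \<in> T \<Longrightarrow> z \<in> B \<Longrightarrow> \<phi> k t z \<in> C"
  and iter_continuous: "continuous_on (T \<times> B) (\<lambda>(t, z). \<phi> k t z)"
proof -
  have "(\<forall>t\<in>T. \<forall>z\<in>B. \<phi> k t z \<in> C) \<and> continuous_on (T \<times> B) (\<lambda>(t, z). \<phi> k t z)"
  proof (induction k)
    case 0
    then show ?case using r_pos by (auto intro!: continuous_intros simp: split_beta)
  next
    case (Suc k)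
    have gc: "continuous_on (T \<times> B) (\<lambda>(t, z). g (\<phi> k t z))"
      unfolding split_beta
      by (rule continuous_on_compose2[OF cont]) (use Suc in \<open>auto simp: split_beta\<close>)
    have "\<phi> (Suc k) t z \<in> C" if "t \<in> T" "z \<in> B" for t z
    proof -
      have "norm (integral {0..1} (\<lambda>s. g (\<phi> k (t * s) z))) \<le> M * (1 - 0)"
        using that Suc scale_T
        by (intro integral_bound scaled_continuous(2)[OF gc] bound) auto
      then have "norm (t *\<^sub>R integral {0..1} (\<lambda>s. g (\<phi> k (t * s) z))) \<le> \<delta> * M"
        using that by (intro scaled_le) auto
      then have "dist (\<phi> (Suc k) t z) z \<le> r"
        using small by (simp add: dist_norm)
      moreover have "dist z0 z < r"
        using that by simp
      ultimately show ?thesis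
        using dist_triangle[of z0 "\<phi> (Suc k) t z" z]
        by (simp add: dist_commute)
    qed
    moreover have "continuous_on (T \<times> B) (\<lambda>(t, z). \<phi> (Suc k) t z)"
      using scaled_integral_continuous[OF gc] by (auto simp: split_beta intro!: continuous_intros)
    ultimately show ?case by blast
  qed
  then show "t \<in> T \<Longrightarrow> z \<in> B \<Longrightarrow> \<phi> k t z \<in> C" "continuous_on (T \<times> B) (\<lambda>(t, z). \<phi> k t z)"
    by blast+
qed

lemma field_iter_continuous: "continuous_on (T \<times> B) (\<lambda>(t, z). g (\<phi> k t z))"
  unfolding split_beta
  by (rule continuous_on_compose2[OF cont])
    (use iter_in_C iter_continuous[of k, unfolded split_beta] in auto)

lemma field_deriv_iter_continuous: "continuous_on (T \<times> B) (\<lambda>(t, z). g' (\<phi> k t z))"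
  unfolding split_beta
  by (rule continuous_on_compose2[OF cont'])
    (use iter_in_C iter_continuous[of k, unfolded split_beta] in auto)

lemma deriv_continuous: "continuous_on (T \<times> B) (\<lambda>(t, z). A k t z)"
proof (induction k)
  case 0
  then show ?case by (simp add: split_beta)
next
  case (Suc k)
  have "continuous_on (T \<times> B) (\<lambda>(t, z). g' (\<phi> k t z) o\<^sub>L A k t z)"
    using field_deriv_iter_continuous[of k] Suc by (auto simp: split_beta intro!: continuous_intros)
  from scaled_integral_continuous[OF this] show ?case
    by (auto simp: split_beta intro!: continuous_intros)
qed

lemma deriv_integrand_continuous: "continuous_on (T \<times> B) (\<lambda>(t, z). g' (\<phi> k t z) o\<^sub>L A k t z)"
  using field_deriv_iter_continuous[of k] deriv_continuous[of k]
  by (auto simp: split_beta intro!: continuous_intros)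

lemma norm_deriv_le: "t \<in> T \<Longrightarrow> z \<in> B \<Longrightarrow> norm (A k t z) \<le> 2"
proof (induction k arbitrary: t)
  case 0
  have "norm (id_blinfun :: 'a \<Rightarrow>\<^sub>L 'a) \<le> 1"
    by (rule norm_blinfun_id_le)
  then show ?case by simp
next
  case (Suc k)
  let ?I = "\<lambda>s. g' (\<phi> k (t * s) z) o\<^sub>L A k (t * s) z"
  have "norm (?I s) \<le> L * 2" if "s \<in> {0..1}" for s
  proof -
    have "t * s \<in> T"
      using Suc.prems that by (intro scale_T)
    then show ?thesis
      using Suc iter_in_C L_nonneg
      by (intro order_trans[OF norm_blinfun_compose] mult_mono bound') auto
  qed
  then have "norm (integral {0..1} ?I) \<le> (L * 2) * (1 - 0)"
    using Suc.prems by (intro integral_bound scaled_continuous(2)[OF deriv_integrand_continuous]) auto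
  then have "norm (t *\<^sub>R integral {0..1} ?I) \<le> \<delta> * (L * 2)"
    using Suc.prems by (intro scaled_le) auto
  then show ?case
    using small' norm_triangle_ineq[of id_blinfun "t *\<^sub>R integral {0..1} ?I"]
      norm_blinfun_id_le[where 'a='a] by (simp add: mult.assoc[symmetric])
qed

lemma iter_has_derivative:
  "t \<in> T \<Longrightarrow> z \<in> B \<Longrightarrow> (\<phi> k t has_derivative blinfun_apply (A k t z)) (at z within B)"
proof (induction k arbitrary: t z)
  case 0
  have "\<phi> 0 t = (\<lambda>z. z)" by auto
  then show ?case by (simp add: has_derivative_ident)
next
  case (Suc k)
  let ?I = "\<lambda>z s. g' (\<phi> k (t * s) z) o\<^sub>L A k (t * s) z"
  have "((\<lambda>z. integral (cbox 0 1) (\<lambda>s. g (\<phi> k (t * s) z)))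
      has_derivative integral (cbox 0 1) (?I z)) (at z within B)"
  proof (rule leibniz_rule)
    fix z s assume zs: "z \<in> B" "s \<in> cbox (0::real) 1"
    then have ts: "t * s \<in> T"
      using Suc.prems scale_T by auto
    show "((\<lambda>z. g (\<phi> k (t * s) z)) has_derivative blinfun_apply (?I z s)) (at z within B)"
      using has_derivative_compose[OF Suc.IH[OF ts zs(1)] deriv[OF iter_in_C[OF ts zs(1)]]]
      by (simp add: blinfun_compose.rep_eq o_def)
  next
    show "(\<lambda>s. g (\<phi> k (t * s) z)) integrable_on cbox 0 1" if "z \<in> B" for z
      using scaled_continuous(2)[OF field_iter_continuous Suc.prems(1) that]
      by (auto intro: integrable_continuous_interval)
    show "continuous_on (B \<times> cbox 0 1) (\<lambda>(z, s). ?I z s)"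
      by (rule scaled_continuous(3)[OF deriv_integrand_continuous Suc.prems(1)])
  qed (use Suc.prems in auto)
  then have "((\<lambda>z. z + t *\<^sub>R integral {0..1} (\<lambda>s. g (\<phi> k (t * s) z)))
      has_derivative (\<lambda>h. h + t *\<^sub>R integral {0..1} (?I z) h)) (at z within B)"
    by (auto intro!: derivative_eq_intros)
  moreover have "\<phi> (Suc k) t = (\<lambda>z. z + t *\<^sub>R integral {0..1} (\<lambda>s. g (\<phi> k (t * s) z)))"
    by auto
  ultimately show ?case
    by (auto elim!: has_derivative_eq_rhs simp: blinfun.add_left blinfun.scaleR_left)
qed

lemma iterates_converge:
  obtains \<Phi> where "uniform_limit (T \<times> B) (\<lambda>k (t, z). \<phi> k t z) \<Phi> sequentially"
proof (rule uniform_limit_of_contraction[where S = "T \<times> B" and u = "\<lambda>k (t, z). \<phi> k t z" and c = "4 * r"])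
  fix j k :: nat and w assume "w \<in> T \<times> B"
  then obtain t z where w: "w = (t, z)" "t \<in> T" "z \<in> B" by auto
  show "dist (case w of (t, z) \<Rightarrow> \<phi> j t z) (case w of (t, z) \<Rightarrow> \<phi> k t z) \<le> 4 * r"
    using iter_in_C[OF w(2,3), of j] iter_in_C[OF w(2,3), of k]
      dist_triangle[of "\<phi> j t z" "\<phi> k t z" z0] by (simp add: w dist_commute)
next
  fix e :: real and N
  assume e: "e > 0" and *: "\<And>j k w. N \<le> j \<Longrightarrow> N \<le> k \<Longrightarrow> w \<in> T \<times> B \<Longrightarrow>
    dist (case w of (t, z) \<Rightarrow> \<phi> j t z) (case w of (t, z) \<Rightarrow> \<phi> k t z) \<le> e"
  have "dist (\<phi> (Suc j) t z) (\<phi> (Suc k) t z) \<le> 3/4 * e"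
    if "N \<le> j" "N \<le> k" "t \<in> T" "z \<in> B" for j k t z
  proof -
    let ?g = "\<lambda>k s. g (\<phi> k (t * s) z)"
    have "norm (integral {0..1} (?g j) - integral {0..1} (?g k)) \<le> L * e"
    proof (rule norm_integral_diff_le)
      fix s :: real assume "s \<in> {0..1}"
      then have ts: "t * s \<in> T"
        using that scale_T by auto
      show "norm (?g j s - ?g k s) \<le> L * e"
        using *[OF that(1,2), of "(t * s, z)"] ts that(4) L_nonneg
        by (intro order_trans[OF lipschitz] mult_left_mono iter_in_C) (auto simp: dist_norm)
    qed (rule scaled_continuous(2)[OF field_iter_continuous that(3,4)])+
    then have "norm (t *\<^sub>R (integral {0..1} (?g j) - integral {0..1} (?g k))) \<le> \<delta> * (L * e)"
      using that by (intro scaled_le) auto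
    also have "\<dots> \<le> 1/2 * e"
      using mult_right_mono[OF small', of e] e by (simp add: mult.assoc)
    finally show ?thesis
      using e by (simp add: dist_norm scaleR_diff_right)
  qed
  then have "dist (\<phi> j t z) (\<phi> k t z) \<le> 3/4 * e"
    if "Suc N \<le> j" "Suc N \<le> k" "t \<in> T" "z \<in> B" for j k t z
    using that by (cases j; cases k) auto
  then show "\<exists>N'. \<forall>j\<ge>N'. \<forall>k\<ge>N'. \<forall>w\<in>T \<times> B.
      dist (case w of (t, z) \<Rightarrow> \<phi> j t z) (case w of (t, z) \<Rightarrow> \<phi> k t z) \<le> 3/4 * e"
    by (intro exI[of _ "Suc N"]) auto
qed (use that in blast)

text \<open>
  The recursion for the derivatives contracts as well, up to the difference of \<open>g'\<close> at two iterates;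
  this difference becomes small because \<open>g'\<close> is uniformly continuous on the compact ball and the
  iterates converge uniformly.
\<close>

lemma derivs_converge:
  obtains D where "uniform_limit (T \<times> B) (\<lambda>k (t, z). A k t z) D sequentially"
proof (rule uniform_limit_of_contraction[where S = "T \<times> B" and u = "\<lambda>k (t, z). A k t z" and c = 4])
  fix j k :: nat and w assume "w \<in> T \<times> B"
  then obtain t z where w: "w = (t, z)" "t \<in> T" "z \<in> B" by auto
  show "dist (case w of (t, z) \<Rightarrow> A j t z) (case w of (t, z) \<Rightarrow> A k t z) \<le> 4"
    using norm_deriv_le[OF w(2,3), of j] norm_deriv_le[OF w(2,3), of k]
      norm_triangle_ineq4[of "A j t z" "A k t z"] by (simp add: w dist_norm)
next
  fix e :: real and N
  assume e: "e > 0" and *: "\<And>j k w. N \<le> j \<Longrightarrow> N \<le> k \<Longrightarrow> w \<in> T \<times> B \<Longrightarrow>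
    dist (case w of (t, z) \<Rightarrow> A j t z) (case w of (t, z) \<Rightarrow> A k t z) \<le> e"
  \<comment> \<open>The error \<open>\<delta> * (\<eta> * 2) = e/4\<close> and the contraction \<open>e/2\<close> add up to \<open>3/4 * e\<close>.\<close>
  define \<eta> where "\<eta> = e / (8 * \<delta>)"
  have \<eta>: "\<eta> > 0" "\<delta> * (\<eta> * 2) = e / 4"
    using e \<delta>_pos by (auto simp: \<eta>_def)
  have "uniformly_continuous_on C g'"
    by (intro compact_uniformly_continuous cont' compact_cball)
  then obtain d where d: "d > 0" "\<And>x y. x \<in> C \<Longrightarrow> y \<in> C \<Longrightarrow> dist x y < d \<Longrightarrow> dist (g' x) (g' y) < \<eta>"
    unfolding uniformly_continuous_on_def using \<eta>(1) by metis
  have "uniformly_Cauchy_on (T \<times> B) (\<lambda>k (t, z). \<phi> k t z)"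
  proof -
    obtain \<Phi> where "uniform_limit (T \<times> B) (\<lambda>k (t, z). \<phi> k t z) \<Phi> sequentially"
      using iterates_converge .
    from uniformly_convergentI[OF this] show ?thesis
      by (simp only: uniformly_convergent_eq_Cauchy)
  qed
  then have "\<exists>M. \<forall>w\<in>T \<times> B. \<forall>j\<ge>M. \<forall>k\<ge>M.
      dist (case w of (t, z) \<Rightarrow> \<phi> j t z) (case w of (t, z) \<Rightarrow> \<phi> k t z) < d"
    using d(1) by (simp only: uniformly_Cauchy_on_def)
  then obtain N1 where N1: "\<And>w j k. w \<in> T \<times> B \<Longrightarrow> j \<ge> N1 \<Longrightarrow> k \<ge> N1 \<Longrightarrow>
      dist (case w of (t, z) \<Rightarrow> \<phi> j t z) (case w of (t, z) \<Rightarrow> \<phi> k t z) < d"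
    by blast
  have "dist (A (Suc j) t z) (A (Suc k) t z) \<le> 3/4 * e"
    if "max N N1 \<le> j" "max N N1 \<le> k" "t \<in> T" "z \<in> B" for j k t z
  proof -
    let ?I = "\<lambda>k s. g' (\<phi> k (t * s) z) o\<^sub>L A k (t * s) z"
    have "norm (integral {0..1} (?I j) - integral {0..1} (?I k)) \<le> \<eta> * 2 + L * e"
    proof (rule norm_integral_diff_le)
      fix s :: real assume "s \<in> {0..1}"
      then have ts: "t * s \<in> T"
        using that scale_T by auto
      let ?x = "\<phi> j (t * s) z" and ?y = "\<phi> k (t * s) z"
      let ?P = "A j (t * s) z" and ?Q = "A k (t * s) z"
      have "dist ?x ?y < d" "dist ?P ?Q \<le> e"
        using N1[of "(t * s, z)" j k] *[of j k "(t * s, z)"] that ts by auto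
      then have xy: "norm (g' ?x - g' ?y) \<le> \<eta>" "norm (?P - ?Q) \<le> e"
        using d(2)[OF iter_in_C[OF ts that(4)] iter_in_C[OF ts that(4)]]
        by (simp_all add: dist_norm less_imp_le)
      have eq: "?I j s - ?I k s = ((g' ?x - g' ?y) o\<^sub>L ?P) + (g' ?y o\<^sub>L (?P - ?Q))"
        by (rule blinfun_eqI) (simp add: blinfun.diff_left blinfun.add_left blinfun.diff_right)
      have "norm (?I j s - ?I k s) \<le> norm (g' ?x - g' ?y) * norm ?P + norm (g' ?y) * norm (?P - ?Q)"
        unfolding eq by (intro norm_triangle_mono norm_blinfun_compose)
      also have "\<dots> \<le> \<eta> * 2 + L * e"
        using \<eta>(1) L_nonneg
        by (intro add_mono mult_mono xy norm_deriv_le[OF ts that(4)] bound'[OF iter_in_C[OF ts that(4)]]) simp_all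
      finally show "norm (?I j s - ?I k s) \<le> \<eta> * 2 + L * e" .
    qed (rule scaled_continuous(2)[OF deriv_integrand_continuous that(3,4)])+
    then have "norm (t *\<^sub>R (integral {0..1} (?I j) - integral {0..1} (?I k))) \<le> \<delta> * (\<eta> * 2 + L * e)"
      using that by (intro scaled_le) auto
    also have "\<dots> \<le> e / 4 + 1/2 * e"
      unfolding distrib_left \<eta>(2) using mult_right_mono[OF small', of e] e
      by (simp only: mult.assoc add_left_mono less_imp_le)
    finally show ?thesis
      using e by (simp add: dist_norm scaleR_diff_right)
  qed
  then have "dist (A j t z) (A k t z) \<le> 3/4 * e"
    if "Suc (max N N1) \<le> j" "Suc (max N N1) \<le> k" "t \<in> T" "z \<in> B" for j k t z
    using that by (cases j; cases k) auto
  then show "\<exists>N'. \<forall>j\<ge>N'. \<forall>k\<ge>N'. \<forall>w\<in>T \<times> B.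
      dist (case w of (t, z) \<Rightarrow> A j t z) (case w of (t, z) \<Rightarrow> A k t z) \<le> 3/4 * e"
    by (intro exI[of _ "Suc (max N N1)"]) auto
qed (use that in blast)

lemma limit_integral_equation:
  assumes lim: "uniform_limit (T \<times> B) (\<lambda>k (t, z). \<phi> k t z) \<Phi> sequentially"
  shows "continuous_on (T \<times> B) \<Phi>"
    and "t \<in> T \<Longrightarrow> z \<in> B \<Longrightarrow> \<Phi> (t, z) \<in> C"
    and "t \<in> T \<Longrightarrow> z \<in> B \<Longrightarrow> \<Phi> (t, z) = z + t *\<^sub>R integral {0..1} (\<lambda>s. g (\<Phi> (t * s, z)))"
proof -
  show c: "continuous_on (T \<times> B) \<Phi>"
    by (rule uniform_limit_theorem[OF _ lim]) (auto intro!: always_eventually iter_continuous)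
  have pt: "(\<lambda>k. \<phi> k t z) \<longlonglongrightarrow> \<Phi> (t, z)" if "t \<in> T" "z \<in> B" for t z
    using tendsto_uniform_limitI[OF lim, of "(t, z)"] that by auto
  show in_C: "\<Phi> (t, z) \<in> C" if "t \<in> T" "z \<in> B" for t z
    using Lim_in_closed_set[OF closed_cball _ _ pt[OF that]] iter_in_C[OF that] by auto
  show "\<Phi> (t, z) = z + t *\<^sub>R integral {0..1} (\<lambda>s. g (\<Phi> (t * s, z)))" if tz: "t \<in> T" "z \<in> B"
  proof (rule LIMSEQ_unique)
    show "(\<lambda>k. \<phi> (Suc k) t z) \<longlonglongrightarrow> \<Phi> (t, z)"
      using pt[OF tz] by (rule LIMSEQ_Suc)
    show "(\<lambda>k. \<phi> (Suc k) t z) \<longlonglongrightarrow> z + t *\<^sub>R integral {0..1} (\<lambda>s. g (\<Phi> (t * s, z)))"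
    proof (rule tendstoI)
      fix e :: real assume e: "e > 0"
      let ?I = "\<lambda>s. g (\<Phi> (t * s, z))" and ?J = "\<lambda>k s. g (\<phi> k (t * s) z)"
      have "continuous_on (T \<times> B) (\<lambda>(t, z). g (\<Phi> (t, z)))"
        unfolding split_beta using in_C by (auto intro!: continuous_on_compose2[OF cont] c)
      then have cI: "continuous_on {0..1} ?I"
        using scaled_continuous(2)[of "\<lambda>t z. g (\<Phi> (t, z))"] tz by auto
      have "\<forall>\<^sub>F k in sequentially. \<forall>w\<in>T \<times> B. dist (case w of (t, z) \<Rightarrow> \<phi> k t z) (\<Phi> w) < e"
        using uniform_limitD[OF lim e] .
      then show "\<forall>\<^sub>F k in sequentially. dist (\<phi> (Suc k) t z) (z + t *\<^sub>R integral {0..1} ?I) < e"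
      proof eventually_elim
        case (elim k)
        have "norm (integral {0..1} (?J k) - integral {0..1} ?I) \<le> L * e"
        proof (rule norm_integral_diff_le[OF _ cI])
          fix s :: real assume "s \<in> {0..1}"
          then have ts: "t * s \<in> T"
            using tz scale_T by auto
          then show "norm (?J k s - ?I s) \<le> L * e"
            using elim tz L_nonneg
            by (intro order_trans[OF lipschitz] mult_left_mono iter_in_C in_C)
              (force simp: dist_norm)+
        qed (rule scaled_continuous(2)[OF field_iter_continuous tz])
        then have "norm (t *\<^sub>R (integral {0..1} (?J k) - integral {0..1} ?I)) \<le> \<delta> * (L * e)"
          using tz by (intro scaled_le) auto
        also have "\<dots> \<le> 1/2 * e"
          using mult_right_mono[OF small', of e] e by (simp add: mult.assoc)
        finally show ?case
          using e by (simp add: dist_norm scaleR_diff_right)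
      qed
    qed
  qed
qed

lemma limit_has_derivative:
  assumes lim: "uniform_limit (T \<times> B) (\<lambda>k (t, z). \<phi> k t z) \<Phi> sequentially"
    and limD: "uniform_limit (T \<times> B) (\<lambda>k (t, z). A k t z) D sequentially"
    and tz: "t \<in> T" "z \<in> B"
  shows "((\<lambda>z. \<Phi> (t, z)) has_derivative blinfun_apply (D (t, z))) (at z within B)"
proof -
  have pt: "(\<lambda>k. \<phi> k t z) \<longlonglongrightarrow> \<Phi> (t, z)" if "z \<in> B" for z
    using tendsto_uniform_limitI[OF lim, of "(t, z)"] that tz by auto
  have "\<exists>G. \<forall>z\<in>B. (\<lambda>n. \<phi> n t z) \<longlonglongrightarrow> G z \<and> (G has_derivative blinfun_apply (D (t, z))) (at z within B)"
  proof (rule has_derivative_sequence)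
    fix e :: real assume "e > 0"
    from uniform_limitD[OF limD this]
    show "\<forall>\<^sub>F n in sequentially. \<forall>z\<in>B. \<forall>h.
        norm (blinfun_apply (A n t z) h - blinfun_apply (D (t, z)) h) \<le> e * norm h"
    proof eventually_elim
      case (elim n)
      have "norm (blinfun_apply (A n t z) h - blinfun_apply (D (t, z)) h) \<le> e * norm h"
        if "z \<in> B" for z h
      proof -
        have "norm (A n t z - D (t, z)) \<le> e"
          using elim that tz by (force simp: dist_norm)
        then show ?thesis
          unfolding blinfun.diff_left[symmetric]
          by (intro order_trans[OF norm_blinfun] mult_right_mono) auto
      qed
      then show ?case by blast
    qed
  qed (use tz pt iter_has_derivative in auto)
  then obtain G where G: "\<And>z. z \<in> B \<Longrightarrow> (\<lambda>n. \<phi> n t z) \<longlonglongrightarrow> G z"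
    "\<And>z. z \<in> B \<Longrightarrow> (G has_derivative blinfun_apply (D (t, z))) (at z within B)"
    by blast
  have "G z = \<Phi> (t, z)" if "z \<in> B" for z
    using LIMSEQ_unique[OF G(1) pt] that by blast
  then show ?thesis
    by (intro has_derivative_transform[OF tz(2) _ G(2)[OF tz(2)]]) simp
qed

text \<open>
  With a primitive \<open>H\<close> of \<open>t \<mapsto> g (\<Phi> (t, z))\<close> the rescaled integral becomes \<open>H t - H 0\<close>, also for
  negative \<open>t\<close>, and can be differentiated.
\<close>

lemma limit_solves:
  assumes lim: "uniform_limit (T \<times> B) (\<lambda>k (t, z). \<phi> k t z) \<Phi> sequentially"
    and t: "t \<in> {-\<delta><..<\<delta>}" and z: "z \<in> B"
  shows "((\<lambda>t. \<Phi> (t, z)) has_vector_derivative g (\<Phi> (t, z))) (at t)"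
proof -
  note \<Phi> = limit_integral_equation[OF lim]
  have "continuous_on T (\<lambda>t. g (\<Phi> (t, z)))"
    using z by (intro continuous_on_compose2[OF cont] continuous_on_compose2[OF \<Phi>(1)]
        continuous_intros) (auto simp del: mem_cball intro!: \<Phi>(2))
  then obtain H where H: "\<And>t. t \<in> T \<Longrightarrow> (H has_vector_derivative g (\<Phi> (t, z))) (at t within T)"
    using antiderivative_continuous by blast
  have eq: "\<Phi> (t, z) = z + (H t - H 0)" if "t \<in> T" for t
  proof -
    have "((H \<circ> (\<lambda>s. t * s)) has_vector_derivative t *\<^sub>R g (\<Phi> (t * s, z))) (at s within {0..1})"
      if "s \<in> {0..1}" for s
    proof (rule vector_diff_chain_within)
      show "((\<lambda>s. t * s) has_vector_derivative t) (at s within {0..1})"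
        by (auto intro!: derivative_eq_intros)
      have "(*) t ` {0..1} \<subseteq> T"
        using scale_T[OF \<open>t \<in> T\<close>] by auto
      then show "(H has_vector_derivative g (\<Phi> (t * s, z))) (at (t * s) within (*) t ` {0..1})"
        using H[OF scale_T[OF \<open>t \<in> T\<close> that]] has_vector_derivative_within_subset by blast
    qed
    from fundamental_theorem_of_calculus[OF _ this]
    have "((\<lambda>s. t *\<^sub>R g (\<Phi> (t * s, z))) has_integral (H t - H 0)) {0..1}"
      by simp
    from integral_unique[OF this] show ?thesis
      using \<Phi>(3)[OF that z] by simp
  qed
  have "(H has_vector_derivative g (\<Phi> (t, z))) (at t)"
    using H[of t] t at_within_interior[of t T] by auto
  then have "((\<lambda>t. z + (H t - H 0)) has_vector_derivative g (\<Phi> (t, z))) (at t)"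
    by (auto intro!: derivative_eq_intros)
  then show ?thesis
    by (rule has_vector_derivative_transform_within_open[where S = "{-\<delta><..<\<delta>}"])
      (use t eq in auto)
qed

text \<open>
  Both partial derivatives of the limit exist and are continuous: in \<open>t\<close> by the differential
  equation, in \<open>z\<close> as a uniform limit.
\<close>

lemma local_flow:
  obtains \<Phi> where "C1_on \<Phi> ({-\<delta><..<\<delta>} \<times> B)"
    and "\<And>t z. t \<in> {-\<delta><..<\<delta>} \<Longrightarrow> z \<in> B \<Longrightarrow> \<Phi> (t, z) \<in> C"
    and "\<And>t z. t \<in> {-\<delta><..<\<delta>} \<Longrightarrow> z \<in> B \<Longrightarrow>
      ((\<lambda>t. \<Phi> (t, z)) has_vector_derivative g (\<Phi> (t, z))) (at t)"
    and "\<And>z. z \<in> B \<Longrightarrow> \<Phi> (0, z) = z"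
proof -
  obtain \<Phi> where \<Phi>: "uniform_limit (T \<times> B) (\<lambda>k (t, z). \<phi> k t z) \<Phi> sequentially"
    using iterates_converge .
  obtain D where D: "uniform_limit (T \<times> B) (\<lambda>k (t, z). A k t z) D sequentially"
    using derivs_converge .
  note \<Phi>' = limit_integral_equation[OF \<Phi>]
  let ?I = "{-\<delta><..<\<delta>}"
  have sub: "?I \<times> B \<subseteq> T \<times> B" by auto
  have Dc: "continuous_on (?I \<times> B) D"
    by (rule continuous_on_subset[OF uniform_limit_theorem[OF _ D] sub])
      (auto intro!: always_eventually deriv_continuous)
  have "C1_on \<Phi> (?I \<times> B)"
  proof (rule C1_onI)
    let ?D = "\<lambda>w. (blinfun_scaleR_left (g (\<Phi> w)) o\<^sub>L fst_blinfun) + (D w o\<^sub>L snd_blinfun)"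
    have "continuous_on (?I \<times> B) (\<lambda>w. g (\<Phi> w))"
      using \<Phi>'(2) by (intro continuous_on_compose2[OF cont] continuous_on_subset[OF \<Phi>'(1) sub])
        (auto simp del: mem_cball)
    with Dc show "continuous_on (?I \<times> B) ?D"
      by (intro continuous_intros)
    fix w assume "w \<in> ?I \<times> B"
    then obtain t z where w: "w = (t, z)" and tz: "t \<in> ?I" "z \<in> B" by auto
    have "((\<lambda>(t, z). \<Phi> (t, z)) has_derivative
        (\<lambda>(h, k). h *\<^sub>R g (\<Phi> (t, z)) + blinfun_apply (D (t, z)) k)) (at (t, z) within ?I \<times> B)"
    proof (rule has_derivative_partialsI)
      show "((\<lambda>t. \<Phi> (t, z)) has_derivative (\<lambda>h. h *\<^sub>R g (\<Phi> (t, z)))) (at t within ?I)"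
        using limit_solves[OF \<Phi> tz] unfolding has_vector_derivative_def
        by (rule has_derivative_at_withinI)
      show "continuous (at (t, z) within ?I \<times> B) (\<lambda>(t, z). D (t, z))"
        using Dc tz by (auto simp: continuous_on_eq_continuous_within)
    qed (use limit_has_derivative[OF \<Phi> D] tz in auto)
    moreover have "at (t, z) within ?I \<times> B = at (t, z)"
      using tz by (intro at_within_open open_Times) auto
    ultimately show "(\<Phi> has_derivative blinfun_apply (?D w)) (at w)"
      by (auto simp: w blinfun.add_left split_beta elim!: has_derivative_eq_rhs)
  qed
  moreover have "\<Phi> (0, z) = z" if "z \<in> B" for z
    using \<Phi>'(3)[OF _ that, of 0] \<delta>_pos by simp
  moreover have "\<Phi> (t, z) \<in> C" if "t \<in> ?I" "z \<in> B" for t z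
    using \<Phi>'(2)[of t z] that by (simp del: mem_cball)
  ultimately show ?thesis
    using that[of \<Phi>] limit_solves[OF \<Phi>] by blast
qed

end

text \<open>
  All constants of the contraction argument are obtained by compactness of a closed ball
  inside the domain.
\<close>

lemma C1_local_flow:
  fixes g :: "'a::euclidean_space \<Rightarrow> 'a"
  assumes "open U" "C1_on g U" "z0 \<in> U"
  obtains e \<Phi> where "e > 0" "C1_on \<Phi> ({-e<..<e} \<times> ball z0 e)"
    and "\<And>t z. t \<in> {-e<..<e} \<Longrightarrow> z \<in> ball z0 e \<Longrightarrow> \<Phi> (t, z) \<in> U"
    and "\<And>t z. t \<in> {-e<..<e} \<Longrightarrow> z \<in> ball z0 e \<Longrightarrow>
      ((\<lambda>t. \<Phi> (t, z)) has_vector_derivative g (\<Phi> (t, z))) (at t)"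
    and "\<And>z. z \<in> ball z0 e \<Longrightarrow> \<Phi> (0, z) = z"
proof -
  obtain g' where g': "\<And>x. x \<in> U \<Longrightarrow> (g has_derivative blinfun_apply (g' x)) (at x)"
    "continuous_on U g'"
    using C1_onD[OF assms(2)] by blast
  obtain R where R: "R > 0" "cball z0 R \<subseteq> U"
    using assms(1,3) open_contains_cball by blast
  have "bounded (g ` cball z0 R)" "bounded (g' ` cball z0 R)"
    using R g'(2) C1_on_continuous_on[OF assms(2)]
    by (auto intro!: compact_imp_bounded compact_continuous_image intro: continuous_on_subset)
  then obtain M L where "\<forall>y\<in>g ` cball z0 R. norm y \<le> M" and M_pos: "M > 0"
    and "\<forall>y\<in>g' ` cball z0 R. norm y \<le> L" and L_pos: "L > 0"
    unfolding bounded_pos by blast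
  then have M: "norm (g x) \<le> M" and L: "norm (g' x) \<le> L" if "x \<in> cball z0 R" for x
    using that by blast+
  define \<delta> where "\<delta> = min ((R / 2) / M) ((1 / 2) / L)"
  have "\<delta> \<le> (R / 2) / M" "\<delta> \<le> (1 / 2) / L" and \<delta>: "\<delta> > 0"
    using M_pos L_pos R by (auto simp: \<delta>_def)
  then have "\<delta> * M \<le> R / 2" "\<delta> * L \<le> 1 / 2"
    using M_pos L_pos by (auto simp: pos_le_divide_eq)
  then interpret picard_ball g g' z0 "R / 2" \<delta> M L
    using R \<delta> M L g' continuous_on_subset[OF g'(2) R(2)] by unfold_locales auto
  obtain \<Phi> where \<Phi>: "C1_on \<Phi> ({-\<delta><..<\<delta>} \<times> ball z0 (R / 2))"
    "\<And>t z. t \<in> {-\<delta><..<\<delta>} \<Longrightarrow> z \<in> ball z0 (R / 2) \<Longrightarrow> \<Phi> (t, z) \<in> cball z0 (2 * (R / 2))"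
    "\<And>t z. t \<in> {-\<delta><..<\<delta>} \<Longrightarrow> z \<in> ball z0 (R / 2) \<Longrightarrow>
      ((\<lambda>t. \<Phi> (t, z)) has_vector_derivative g (\<Phi> (t, z))) (at t)"
    "\<And>z. z \<in> ball z0 (R / 2) \<Longrightarrow> \<Phi> (0, z) = z"
    using local_flow by blast
  define e where "e = min \<delta> (R / 2)"
  have e: "e > 0" "{-e<..<e} \<subseteq> {-\<delta><..<\<delta>}" "ball z0 e \<subseteq> ball z0 (R / 2)"
    using \<delta> R by (auto simp: e_def)
  then have "{-e<..<e} \<times> ball z0 e \<subseteq> {-\<delta><..<\<delta>} \<times> ball z0 (R / 2)" by blast
  note C1_on_subset[OF \<Phi>(1) this]
  moreover have "\<Phi> (t, z) \<in> U" if "t \<in> {-e<..<e}" "z \<in> ball z0 e" for t z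
  proof -
    have "t \<in> {-\<delta><..<\<delta>}" "z \<in> ball z0 (R / 2)"
      using that e(2,3) by blast+
    from \<Phi>(2)[OF this] show ?thesis
      using R(2) by auto
  qed
  ultimately show ?thesis
    using that[of e \<Phi>] e \<Phi>(3,4) by blast
qed

section \<open>Solutions of the differential equation\<close>

definition solves :: "'n::finite vector_field \<Rightarrow> real set \<Rightarrow> (real \<Rightarrow> real ^ 'n) \<Rightarrow> bool"
  where "solves f J x \<longleftrightarrow> open_interval J \<and>
    (\<forall>\<tau>\<in>J. (\<tau>, x \<tau>) \<in> Dom f \<and> (x has_vector_derivative app f (\<tau>, x \<tau>)) (at \<tau>))"

lemma solvesD:
  assumes "solves f J x"
  shows "open J" "is_interval J" "\<tau> \<in> J \<Longrightarrow> (\<tau>, x \<tau>) \<in> Dom f"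
    "\<tau> \<in> J \<Longrightarrow> (x has_vector_derivative app f (\<tau>, x \<tau>)) (at \<tau>)" "continuous_on J x"
proof -
  show "open J" "is_interval J" "\<tau> \<in> J \<Longrightarrow> (\<tau>, x \<tau>) \<in> Dom f"
    and deriv: "\<tau> \<in> J \<Longrightarrow> (x has_vector_derivative app f (\<tau>, x \<tau>)) (at \<tau>)" for \<tau>
    using assms by (simp_all add: solves_def open_interval_def)
  show "continuous_on J x"
    using has_vector_derivative_continuous[OF deriv] by (simp add: continuous_at_imp_continuous_on)
qed

lemma solves_local:
  assumes "open_interval J"
    and "\<And>\<tau>. \<tau> \<in> J \<Longrightarrow> \<exists>I x. \<tau> \<in> I \<and> solves f I x \<and> (\<forall>s\<in>I. y s = x s)"
  shows "solves f J y"
  unfolding solves_def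
proof (intro conjI ballI)
  fix \<tau> assume "\<tau> \<in> J"
  from assms(2)[OF this] obtain I x
    where I: "\<tau> \<in> I" and x: "solves f I x" and eq: "\<forall>s\<in>I. y s = x s"
    by blast
  have y: "y \<tau> = x \<tau>"
    using I eq by blast
  show "(\<tau>, y \<tau>) \<in> Dom f"
    unfolding y by (rule solvesD(3)[OF x I])
  show "(y has_vector_derivative app f (\<tau>, y \<tau>)) (at \<tau>)"
    unfolding y
  proof (rule has_vector_derivative_transform_within_open)
    show "(x has_vector_derivative app f (\<tau>, x \<tau>)) (at \<tau>)" "open I" "\<tau> \<in> I"
      using solvesD(1,4)[OF x] I by auto
    show "x s = y s" if "s \<in> I" for s
      using that eq by simp
  qed
qed (fact assms(1))

lemma solves_cong:
  assumes "solves f J x" "\<And>\<tau>. \<tau> \<in> J \<Longrightarrow> y \<tau> = x \<tau>"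
  shows "solves f J y"
proof (rule solves_local)
  show "open_interval J"
    using assms(1) by (simp add: solves_def)
  show "\<exists>I x'. \<tau> \<in> I \<and> solves f I x' \<and> (\<forall>s\<in>I. y s = x' s)" if "\<tau> \<in> J" for \<tau>
    using assms that by (intro exI[of _ J] exI[of _ x]) simp
qed

lemma is_solution_iff: "is_solution f y \<longleftrightarrow> Dom y \<noteq> {} \<and> Codom y = UNIV \<and> solves f (Dom y) (app y)"
  by (auto simp: is_solution_def solves_def)

lemma is_solution_mk_func:
  assumes "solves f J x" "J \<noteq> {}"
  shows "is_solution f (mk_func J UNIV x)"
  unfolding is_solution_iff
  using assms(2) solves_cong[OF assms(1), of "app (mk_func J UNIV x)"] by (simp add: mk_func_sel)

locale C1_field =
  fixes f :: "'n::finite vector_field"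
  assumes open_Dom: "open (Dom f)" and C1: "C1_on (app f) (Dom f)"
begin

lemma local_lipschitz_in_space:
  assumes "w \<in> Dom f"
  obtains R L where "R > 0" "L > 0"
    "\<And>t u v. (t, u) \<in> ball w R \<Longrightarrow> (t, v) \<in> ball w R \<Longrightarrow>
      norm (app f (t, u) - app f (t, v)) \<le> L * norm (u - v)"
proof -
  obtain f' where f': "\<And>x. x \<in> Dom f \<Longrightarrow> (app f has_derivative blinfun_apply (f' x)) (at x)"
    "continuous_on (Dom f) f'"
    using C1_onD[OF C1] by blast
  obtain R where R: "R > 0" "cball w R \<subseteq> Dom f"
    using open_Dom assms open_contains_cball by blast
  have "bounded (f' ` cball w R)"
    using R f'(2)
    by (auto intro!: compact_imp_bounded compact_continuous_image intro: continuous_on_subset)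
  then obtain L where L: "L > 0" "\<forall>y\<in>f' ` cball w R. norm y \<le> L"
    unfolding bounded_pos by blast
  have *: "norm (app f (t, u) - app f (t, v)) \<le> L * norm ((t, u) - (t, v))"
    if tuv: "(t, u) \<in> ball w R" "(t, v) \<in> ball w R" for t u v
  proof (rule differentiable_bound[where S = "ball w R" and f' = "\<lambda>x. blinfun_apply (f' x)"])
    fix x assume x: "x \<in> ball w R"
    then have "x \<in> cball w R" by simp
    then show "onorm (blinfun_apply (f' x)) \<le> L"
      using L(2) by (simp add: norm_blinfun.rep_eq)
    show "(app f has_derivative blinfun_apply (f' x)) (at x within ball w R)"
      by (rule has_derivative_at_withinI[OF f'(1)[OF subsetD[OF R(2) \<open>x \<in> cball w R\<close>]]])
  qed (use tuv in simp_all)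
  show ?thesis
  proof (rule that[OF R(1) L(1)])
    fix t u v assume "(t, u) \<in> ball w R" "(t, v) \<in> ball w R"
    from *[OF this] show "norm (app f (t, u) - app f (t, v)) \<le> L * norm (u - v)"
      by (simp add: norm_Pair)
  qed
qed

lemma solves_unique_local:
  assumes x: "solves f J x" and y: "solves f J' y"
    and t0: "t0 \<in> J" "t0 \<in> J'" "x t0 = y t0"
  shows "\<exists>\<delta>>0. \<forall>t\<in>ball t0 \<delta>. x t = y t"
proof -
  note x = solvesD[OF x] and y = solvesD[OF y]
  let ?w = "(t0, x t0)"
  obtain R L where RL: "R > 0" "L > 0"
    "\<And>t u v. (t, u) \<in> ball ?w R \<Longrightarrow> (t, v) \<in> ball ?w R \<Longrightarrow>
      norm (app f (t, u) - app f (t, v)) \<le> L * norm (u - v)"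
    using local_lipschitz_in_space[OF x(3)[OF t0(1)]] by blast
  have "open (J \<inter> (\<lambda>t. (t, x t)) -` ball ?w R)" "open (J' \<inter> (\<lambda>t. (t, y t)) -` ball ?w R)"
    using x y by (auto intro!: continuous_open_preimage continuous_intros)
  then have "open ((J \<inter> (\<lambda>t. (t, x t)) -` ball ?w R) \<inter> (J' \<inter> (\<lambda>t. (t, y t)) -` ball ?w R))"
    by (rule open_Int)
  moreover have "t0 \<in> (J \<inter> (\<lambda>t. (t, x t)) -` ball ?w R) \<inter> (J' \<inter> (\<lambda>t. (t, y t)) -` ball ?w R)"
    using t0 RL(1) by simp
  ultimately obtain d where d: "d > 0"
    "cball t0 d \<subseteq> (J \<inter> (\<lambda>t. (t, x t)) -` ball ?w R) \<inter> (J' \<inter> (\<lambda>t. (t, y t)) -` ball ?w R)"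
    unfolding open_contains_cball by blast
  define \<delta> where "\<delta> = min d (1 / (2 * L))"
  have \<delta>: "\<delta> > 0" "cball t0 \<delta> \<subseteq> cball t0 d" "\<delta> \<le> 1 / (2 * L)"
    using d(1) RL(2) by (auto simp: \<delta>_def)
  have \<delta>L: "L * \<delta> \<le> 1/2"
    using mult_left_mono[OF \<delta>(3), of L] RL(2) by simp
  have sub: "cball t0 \<delta> \<subseteq> (J \<inter> (\<lambda>t. (t, x t)) -` ball ?w R) \<inter> (J' \<inter> (\<lambda>t. (t, y t)) -` ball ?w R)"
    using d(2) \<delta>(2) by blast
  let ?u = "\<lambda>t. x t - y t"
  have "continuous_on (cball t0 \<delta>) (\<lambda>t. norm (?u t))"
    using sub by (intro continuous_on_norm continuous_on_diff
        continuous_on_subset[OF x(5)] continuous_on_subset[OF y(5)]) blast+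
  then obtain t1 where t1: "t1 \<in> cball t0 \<delta>" "\<And>t. t \<in> cball t0 \<delta> \<Longrightarrow> norm (?u t) \<le> norm (?u t1)"
    using continuous_attains_sup[of "cball t0 \<delta>" "\<lambda>t. norm (?u t)"] \<delta>(1) by auto
  \<comment> \<open>At a point where the distance of the two solutions is maximal, the mean value inequality
     bounds this maximum by half of itself.\<close>
  have "norm (?u t1 - ?u t0) \<le> (L * norm (?u t1)) * norm (t1 - t0)"
  proof (rule differentiable_bound[where S = "cball t0 \<delta>"])
    fix t assume t: "t \<in> cball t0 \<delta>"
    then have t': "t \<in> J" "t \<in> J'" "(t, x t) \<in> ball ?w R" "(t, y t) \<in> ball ?w R"
      using sub by blast+
    let ?D = "app f (t, x t) - app f (t, y t)"
    have "(?u has_vector_derivative ?D) (at t within cball t0 \<delta>)"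
      by (rule has_vector_derivative_diff[OF
            has_vector_derivative_at_within[OF x(4)[OF t'(1)]]
            has_vector_derivative_at_within[OF y(4)[OF t'(2)]]])
    then show "(?u has_derivative (\<lambda>h. h *\<^sub>R ?D)) (at t within cball t0 \<delta>)"
      unfolding has_vector_derivative_def .
    have "norm ?D \<le> L * norm (?u t)"
      by (rule RL(3)[OF t'(3,4)])
    also have "\<dots> \<le> L * norm (?u t1)"
      using t1(2)[OF t] RL(2) by simp
    finally show "onorm (\<lambda>h. h *\<^sub>R ?D) \<le> L * norm (?u t1)"
      by (intro onorm_le) (simp add: mult.commute mult_left_mono)
  qed (use t1 \<delta> in auto)
  also have "\<dots> \<le> (L * norm (?u t1)) * \<delta>"
    using t1(1) RL(2) by (intro mult_left_mono) (auto simp: dist_norm norm_minus_commute)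
  also have "\<dots> \<le> (1/2) * norm (?u t1)"
    using mult_right_mono[OF \<delta>L, of "norm (?u t1)"] by (simp add: mult_ac)
  finally have "norm (?u t1) \<le> 0"
    using t0(3) by simp
  then have "x t = y t" if "t \<in> ball t0 \<delta>" for t
    using t1(2)[of t] that by simp
  with \<delta>(1) show ?thesis by blast
qed

text \<open>
  The set of times at which two solutions agree is open by the local statement and relatively
  closed by continuity.
\<close>

lemma solves_unique:
  assumes x: "solves f J x" and y: "solves f J' y"
    and \<rho>: "\<rho> \<in> J" "\<rho> \<in> J'" "x \<rho> = y \<rho>" and \<tau>: "\<tau> \<in> J" "\<tau> \<in> J'"
  shows "x \<tau> = y \<tau>"
proof (rule ccontr)
  assume neq: "x \<tau> \<noteq> y \<tau>"
  note x' = solvesD[OF x] and y' = solvesD[OF y]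
  let ?I = "J \<inter> J'"
  let ?E = "{t \<in> ?I. x t = y t}" and ?N = "{t \<in> ?I. x t \<noteq> y t}"
  have "open ?E"
    unfolding open_contains_ball
  proof
    fix t assume t: "t \<in> ?E"
    then obtain \<delta> where "\<delta> > 0" "\<forall>s\<in>ball t \<delta>. x s = y s"
      using solves_unique_local[OF x y] by blast
    moreover obtain d where "d > 0" "ball t d \<subseteq> ?I"
      using t open_Int[OF x'(1) y'(1)] open_contains_ball by blast
    ultimately show "\<exists>e>0. ball t e \<subseteq> ?E"
      by (intro exI[of _ "min \<delta> d"]) auto
  qed
  moreover have "open (?I \<inter> (\<lambda>t. x t - y t) -` (- {0}))"
    using x' y' by (intro continuous_open_preimage continuous_intros)
      (auto intro: continuous_on_subset)
  moreover have "?I \<inter> (\<lambda>t. x t - y t) -` (- {0}) = ?N" by auto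
  ultimately have "open ?E" "open ?N" by simp_all
  moreover have "connected ?I"
    using x'(2) y'(2) by (simp add: is_interval_Int is_interval_connected)
  ultimately have "?E \<inter> ?I = {} \<or> ?N \<inter> ?I = {}"
    by (intro connectedD) auto
  with \<rho> \<tau> neq show False by auto
qed

text \<open>
  All solutions through one given point, of which there may be infinitely many, agree where they
  meet; their union is therefore again a solution.
\<close>

lemma solves_Union:
  assumes fam: "\<And>J x. (J, x) \<in> \<F> \<Longrightarrow> solves f J x \<and> \<rho> \<in> J \<and> x \<rho> = a"
  obtains X where "solves f (\<Union>(fst ` \<F>)) X" "\<And>J x \<tau>. (J, x) \<in> \<F> \<Longrightarrow> \<tau> \<in> J \<Longrightarrow> X \<tau> = x \<tau>"
proof
  define X where "X \<tau> = (SOME v. \<exists>(J, x) \<in> \<F>. \<tau> \<in> J \<and> v = x \<tau>)" for \<tau>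
  show eq: "X \<tau> = x \<tau>" if Jx: "(J, x) \<in> \<F>" "\<tau> \<in> J" for J x \<tau>
  proof -
    have "\<exists>(J, x) \<in> \<F>. \<tau> \<in> J \<and> X \<tau> = x \<tau>"
      unfolding X_def by (rule someI[of _ "x \<tau>"]) (use that in blast)
    then obtain J' x' where J': "(J', x') \<in> \<F>" "\<tau> \<in> J'" "X \<tau> = x' \<tau>"
      by auto
    then show ?thesis
      using solves_unique[of J' x' J x \<rho> \<tau>] fam[OF J'(1)] fam[OF Jx(1)] Jx(2) by simp
  qed
  have "is_interval J" "open J" if "(J, x) \<in> \<F>" for J x
    using fam[OF that] solvesD(1,2) by blast+
  moreover have "\<rho> \<in> \<Inter>(fst ` \<F>)"
    using fam by auto
  ultimately have "connected (\<Union>(fst ` \<F>))" "open (\<Union>(fst ` \<F>))"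
    by (auto intro!: connected_Union open_Union simp: is_interval_connected)
  then have "open_interval (\<Union>(fst ` \<F>))"
    by (simp add: open_interval_def is_interval_connected_1)
  then show "solves f (\<Union>(fst ` \<F>)) X"
  proof (rule solves_local)
    fix \<tau> assume "\<tau> \<in> \<Union>(fst ` \<F>)"
    then obtain J x where "(J, x) \<in> \<F>" "\<tau> \<in> J"
      by auto
    then show "\<exists>I x. \<tau> \<in> I \<and> solves f I x \<and> (\<forall>s\<in>I. X s = x s)"
      using fam eq by blast
  qed
qed

lemma complete_solution_solves:
  "y \<in> complete_solutions f \<Longrightarrow> solves f (Dom y) (app y)"
  by (simp add: complete_solutions_def is_solution_iff)

lemma complete_solution_extends:
  assumes y: "y \<in> complete_solutions f" "\<rho> \<in> Dom y"
    and x: "solves f J x" "\<rho> \<in> J" "x \<rho> = app y \<rho>"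
  shows "J \<subseteq> Dom y" "\<tau> \<in> J \<Longrightarrow> app y \<tau> = x \<tau>"
proof -
  note y' = complete_solution_solves[OF y(1)]
  obtain X where X: "solves f (\<Union>(fst ` {(Dom y, app y), (J, x)})) X"
    "\<And>I z \<tau>. (I, z) \<in> {(Dom y, app y), (J, x)} \<Longrightarrow> \<tau> \<in> I \<Longrightarrow> X \<tau> = z \<tau>"
    using solves_Union[of "{(Dom y, app y), (J, x)}" \<rho> "app y \<rho>"] x y y' by auto
  let ?z = "mk_func (Dom y \<union> J) UNIV X"
  have z: "is_solution f ?z"
    using X(1) x(2) by (intro is_solution_mk_func) auto
  have "Codom y = UNIV"
    using y(1) by (simp add: complete_solutions_def is_solution_iff)
  then have "restriction_of y ?z"
    using X(2)[of "Dom y" "app y"] by (auto simp: restriction_of_def mk_func_sel)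
  then have "y = ?z"
    using y(1) z unfolding complete_solutions_def by blast
  then have "Dom y = Dom y \<union> J"
    by (metis mk_func_sel(1) Pi_UNIV UNIV_I)
  then show sub: "J \<subseteq> Dom y" by blast
  show "\<tau> \<in> J \<Longrightarrow> app y \<tau> = x \<tau>"
    using solves_unique[OF y' x(1) y(2) x(2)] x(3) sub by auto
qed

lemma complete_solution_unique:
  assumes "y \<in> complete_solutions f" "z \<in> complete_solutions f" "\<rho> \<in> Dom y" "\<rho> \<in> Dom z"
    "app y \<rho> = app z \<rho>"
  shows "y = z"
proof -
  note y = complete_solution_solves[OF assms(1)] and z = complete_solution_solves[OF assms(2)]
  have "Dom z \<subseteq> Dom y" "\<And>\<tau>. \<tau> \<in> Dom z \<Longrightarrow> app y \<tau> = app z \<tau>"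
    using complete_solution_extends[OF assms(1,3) z assms(4) assms(5)[symmetric]] .
  moreover have "Dom y \<subseteq> Dom z"
    using complete_solution_extends(1)[OF assms(2,4) y assms(3,5)] .
  moreover have "Codom y = Codom z"
    using assms by (simp add: complete_solutions_def is_solution_iff)
  ultimately show ?thesis
    by (auto simp: func_eq_iff)
qed

lemma complete_solutionI:
  assumes y: "is_solution f y" "\<rho> \<in> Dom y"
    and max: "\<And>J x. solves f J x \<Longrightarrow> \<rho> \<in> J \<Longrightarrow> x \<rho> = app y \<rho> \<Longrightarrow> J \<subseteq> Dom y"
  shows "y \<in> complete_solutions f"
proof -
  have "y = z" if z: "is_solution f z" "restriction_of y z" for z
  proof -
    have "Dom z \<subseteq> Dom y"
      using z y max[of "Dom z" "app z"] by (auto simp: is_solution_iff restriction_of_def)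
    with z(2) show ?thesis
      by (auto simp: restriction_of_def func_eq_iff)
  qed
  with y(1) show ?thesis
    by (auto simp: complete_solutions_def)
qed

lemma complete_solution_exists:
  assumes "solves f J x" "\<rho> \<in> J"
  obtains y where "y \<in> complete_solutions f" "J \<subseteq> Dom y" "\<And>\<tau>. \<tau> \<in> J \<Longrightarrow> app y \<tau> = x \<tau>"
proof -
  let ?F = "{(I, z). solves f I z \<and> \<rho> \<in> I \<and> z \<rho> = x \<rho>}"
  obtain X where X: "solves f (\<Union>(fst ` ?F)) X"
    "\<And>I z \<tau>. (I, z) \<in> ?F \<Longrightarrow> \<tau> \<in> I \<Longrightarrow> X \<tau> = z \<tau>"
    using solves_Union[of ?F \<rho> "x \<rho>"] by auto
  let ?D = "\<Union>(fst ` ?F)"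
  let ?y = "mk_func ?D UNIV X"
  have Jx: "(J, x) \<in> ?F" using assms by simp
  then have J: "J \<subseteq> ?D" by force
  have sel: "Dom ?y = ?D" "\<And>\<tau>. \<tau> \<in> ?D \<Longrightarrow> app ?y \<tau> = X \<tau>"
    by (simp_all only: mk_func_sel Pi_UNIV UNIV_I)
  have "?y \<in> complete_solutions f"
  proof (rule complete_solutionI)
    show "is_solution f ?y"
      using J assms(2) by (intro is_solution_mk_func[OF X(1)]) blast
    show "\<rho> \<in> Dom ?y"
      using J assms(2) sel by blast
    fix I z assume z: "solves f I z" "\<rho> \<in> I" "z \<rho> = app ?y \<rho>"
    have "app ?y \<rho> = x \<rho>"
      using sel(2)[OF subsetD[OF J assms(2)]] X(2)[OF Jx assms(2)] by simp
    then have "(I, z) \<in> ?F" using z by simp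
    then show "I \<subseteq> Dom ?y" unfolding sel by force
  qed
  moreover have "app ?y \<tau> = x \<tau>" if "\<tau> \<in> J" for \<tau>
    using sel(2)[OF subsetD[OF J that]] X(2)[OF Jx that] by simp
  ultimately show ?thesis
    using that[of ?y] J unfolding sel(1) by blast
qed

text \<open>
  The field \<open>(1, f)\<close> on space-time is autonomous, so that one local flow treats the dependence on
  the initial time and on the initial value together.
\<close>

lemma local_solutions:
  assumes w: "(\<tau>0, a0) \<in> Dom f"
  obtains e \<Psi> where "e > 0"
    and "C1_on \<Psi> ({\<tau>0 - e<..<\<tau>0 + e} \<times> {\<tau>0 - e<..<\<tau>0 + e} \<times> ball a0 e)"
    and "\<And>\<sigma> a. \<sigma> \<in> {\<tau>0 - e<..<\<tau>0 + e} \<Longrightarrow> a \<in> ball a0 e \<Longrightarrow>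
      solves f {\<tau>0 - e<..<\<tau>0 + e} (\<lambda>\<tau>. \<Psi> (\<tau>, \<sigma>, a))"
    and "\<And>\<sigma> a. \<sigma> \<in> {\<tau>0 - e<..<\<tau>0 + e} \<Longrightarrow> a \<in> ball a0 e \<Longrightarrow> \<Psi> (\<sigma>, \<sigma>, a) = a"
proof -
  let ?g = "\<lambda>w. (1 :: real, app f w)"
  have "C1_on (\<lambda>w::real \<times> (real ^ 'n). (1 :: real)) (Dom f)"
    by (rule C1_on_const)
  then have "C1_on ?g (Dom f)"
    using C1 by (rule C1_on_Pair)
  then obtain d \<Phi> where d: "d > 0"
    and \<Phi>: "C1_on \<Phi> ({-d<..<d} \<times> ball (\<tau>0, a0) d)"
    "\<And>t z. t \<in> {-d<..<d} \<Longrightarrow> z \<in> ball (\<tau>0, a0) d \<Longrightarrow> \<Phi> (t, z) \<in> Dom f"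
    "\<And>t z. t \<in> {-d<..<d} \<Longrightarrow> z \<in> ball (\<tau>0, a0) d \<Longrightarrow>
      ((\<lambda>t. \<Phi> (t, z)) has_vector_derivative ?g (\<Phi> (t, z))) (at t)"
    "\<And>z. z \<in> ball (\<tau>0, a0) d \<Longrightarrow> \<Phi> (0, z) = z"
    using C1_local_flow[OF open_Dom _ w, of ?g] by blast
  have time: "fst (\<Phi> (t, z)) = fst z + t"
    if t: "t \<in> {-d<..<d}" and z: "z \<in> ball (\<tau>0, a0) d" for t z
  proof -
    have "((\<lambda>t. fst (\<Phi> (t, z)) - t) has_vector_derivative 0) (at s within {-d<..<d})"
      if "s \<in> {-d<..<d}" for s
    proof -
      have "((\<lambda>t. fst (\<Phi> (t, z))) has_vector_derivative 1) (at s)"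
        using bounded_linear.has_vector_derivative[OF bounded_linear_fst \<Phi>(3)[OF that z]] by simp
      from has_vector_derivative_diff[OF this has_vector_derivative_id] show ?thesis
        by (simp add: has_vector_derivative_at_within)
    qed
    then obtain c where "\<And>s. s \<in> {-d<..<d} \<Longrightarrow> fst (\<Phi> (s, z)) - s = c"
      using has_vector_derivative_zero_constant[of "{-d<..<d}"] by auto
    from this[of 0] this[OF t] show ?thesis
      using d \<Phi>(4)[OF z] by simp
  qed
  define e where "e = d / 2"
  let ?I = "{\<tau>0 - e<..<\<tau>0 + e}"
  let ?S = "\<lambda>(\<tau>, \<sigma>, a). (\<tau> - \<sigma>, \<sigma>, a) :: real \<times> real \<times> (real ^ 'n)"
  define \<Psi> where "\<Psi> w = snd (\<Phi> (?S w))" for w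
  have range: "\<tau> - \<sigma> \<in> {-d<..<d}" "(\<sigma>, a) \<in> ball (\<tau>0, a0) d"
    if "\<tau> \<in> ?I" "\<sigma> \<in> ?I" "a \<in> ball a0 e" for \<tau> \<sigma> a
  proof -
    show "\<tau> - \<sigma> \<in> {-d<..<d}"
      using that by (auto simp: e_def field_simps)
    have "dist (\<tau>0, a0) (\<sigma>, a) \<le> dist \<tau>0 \<sigma> + dist a0 a"
      using norm_Pair_le[of "\<tau>0 - \<sigma>" "a0 - a"] by (simp add: dist_norm)
    also have "\<dots> < e + e"
      using that by (intro add_strict_mono) (auto simp: dist_real_def)
    finally show "(\<sigma>, a) \<in> ball (\<tau>0, a0) d"
      by (simp add: e_def)
  qed
  show ?thesis
  proof
    show "e > 0" using d by (simp add: e_def)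
    have "bounded_linear ?S"
      unfolding split_beta
      by (intro bounded_linear_Pair bounded_linear_sub bounded_linear_fst bounded_linear_snd
          bounded_linear_compose[OF bounded_linear_fst] bounded_linear_compose[OF bounded_linear_snd])
    then have "C1_on ?S (?I \<times> ?I \<times> ball a0 e)"
      by (rule C1_on_bounded_linear)
    then have "C1_on (\<lambda>w. \<Phi> (?S w)) (?I \<times> ?I \<times> ball a0 e)"
    proof (rule C1_on_compose[OF \<Phi>(1)], intro image_subsetI)
      fix w assume "w \<in> ?I \<times> ?I \<times> ball a0 e"
      then obtain \<tau> \<sigma> a where "w = (\<tau>, \<sigma>, a)" "\<tau> \<in> ?I" "\<sigma> \<in> ?I" "a \<in> ball a0 e"
        by blast
      with range[of \<tau> \<sigma> a] show "?S w \<in> {-d<..<d} \<times> ball (\<tau>0, a0) d"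
        by simp
    qed
    then show "C1_on \<Psi> (?I \<times> ?I \<times> ball a0 e)"
      unfolding \<Psi>_def
      by (rule C1_on_compose[OF C1_on_bounded_linear[OF bounded_linear_snd, of UNIV] _ subset_UNIV])
    fix \<sigma> a assume \<sigma>: "\<sigma> \<in> ?I" and a: "a \<in> ball a0 e"
    have dd: "\<Phi> (\<tau> - \<sigma>, \<sigma>, a) = (\<tau>, \<Psi> (\<tau>, \<sigma>, a))" if "\<tau> \<in> ?I" for \<tau>
      using time[OF range[OF that \<sigma> a]] by (simp add: \<Psi>_def prod_eq_iff)
    show "solves f ?I (\<lambda>\<tau>. \<Psi> (\<tau>, \<sigma>, a))"
      unfolding solves_def
    proof (intro conjI ballI)
      show "open_interval ?I"
        by (simp add: open_interval_def is_interval_oo)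
      fix \<tau> assume \<tau>: "\<tau> \<in> ?I"
      note r = range[OF \<tau> \<sigma> a]
      show "(\<tau>, \<Psi> (\<tau>, \<sigma>, a)) \<in> Dom f"
        using \<Phi>(2)[OF r] dd[OF \<tau>] by simp
      have "((\<lambda>\<tau>. \<tau> - \<sigma>) has_vector_derivative 1) (at \<tau>)"
        using has_vector_derivative_diff[OF has_vector_derivative_id
            has_vector_derivative_const[where c = \<sigma>]]
        by fastforce
      from vector_diff_chain_at[OF this \<Phi>(3)[OF r]]
      have "((\<lambda>\<tau>. \<Phi> (\<tau> - \<sigma>, \<sigma>, a)) has_vector_derivative ?g (\<tau>, \<Psi> (\<tau>, \<sigma>, a))) (at \<tau>)"
        by (simp add: o_def dd[OF \<tau>])
      from bounded_linear.has_vector_derivative[OF bounded_linear_snd this]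
      show "((\<lambda>\<tau>. \<Psi> (\<tau>, \<sigma>, a)) has_vector_derivative app f (\<tau>, \<Psi> (\<tau>, \<sigma>, a))) (at \<tau>)"
        by (simp add: \<Psi>_def)
    qed
    show "\<Psi> (\<sigma>, \<sigma>, a) = a"
      using \<Phi>(4)[OF range(2)[OF \<sigma> \<sigma> a]] by (simp add: \<Psi>_def)
  qed
qed

end

section \<open>The Cauchy atlas and its coordinates transformations\<close>

context C1_field
begin

abbreviation "M \<equiv> complete_solutions f"
abbreviation "CT \<equiv> cauchy_transformations f"

lemma cauchy_chart_sel:
  shows "Dom (cauchy_chart f \<tau>) = {x \<in> M. \<tau> \<in> Dom x}"
    and "x \<in> M \<Longrightarrow> \<tau> \<in> Dom x \<Longrightarrow> app (cauchy_chart f \<tau>) x = app x \<tau>"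
proof -
  have "(\<lambda>x. app x \<tau>) \<in> {x \<in> M. \<tau> \<in> Dom x} \<rightarrow> {a. (\<tau>, a) \<in> Dom f}"
    using solvesD(3)[OF complete_solution_solves] by auto
  from mk_func_sel[OF this]
  show "Dom (cauchy_chart f \<tau>) = {x \<in> M. \<tau> \<in> Dom x}"
    and "x \<in> M \<Longrightarrow> \<tau> \<in> Dom x \<Longrightarrow> app (cauchy_chart f \<tau>) x = app x \<tau>"
    by (simp_all add: cauchy_chart_def)
qed

lemma cauchy_chart_inj: "inj_on (app (cauchy_chart f \<rho>)) (Dom (cauchy_chart f \<rho>))"
  using complete_solution_unique by (auto simp: inj_on_def cauchy_chart_sel)

lemma cauchy_transformations_sel:
  shows "Dom (CT \<tau> \<rho>) = {app x \<rho> |x. x \<in> M \<and> \<tau> \<in> Dom x \<and> \<rho> \<in> Dom x}"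
    and "Codom (CT \<tau> \<rho>) = {app x \<tau> |x. x \<in> M \<and> \<tau> \<in> Dom x \<and> \<rho> \<in> Dom x}"
    and "x \<in> M \<Longrightarrow> \<tau> \<in> Dom x \<Longrightarrow> \<rho> \<in> Dom x \<Longrightarrow> app (CT \<tau> \<rho>) (app x \<rho>) = app x \<tau>"
proof -
  let ?\<phi> = "cauchy_chart f \<tau>" and ?\<psi> = "cauchy_chart f \<rho>"
  let ?D = "{x \<in> M. \<tau> \<in> Dom x \<and> \<rho> \<in> Dom x}"
  have D: "Dom ?\<phi> \<inter> Dom ?\<psi> = ?D"
    by (auto simp: cauchy_chart_sel)
  have inv: "the_inv_into (Dom ?\<psi>) (app ?\<psi>) (app x \<rho>) = x" if "x \<in> M" "\<rho> \<in> Dom x" for x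
    using the_inv_into_f_f[OF cauchy_chart_inj, of x \<rho>] that by (simp add: cauchy_chart_sel)
  have im: "app ?\<psi> ` ?D = {app x \<rho> |x. x \<in> M \<and> \<tau> \<in> Dom x \<and> \<rho> \<in> Dom x}"
    "app ?\<phi> ` ?D = {app x \<tau> |x. x \<in> M \<and> \<tau> \<in> Dom x \<and> \<rho> \<in> Dom x}"
    by (force simp: cauchy_chart_sel image_iff)+
  let ?h = "\<lambda>a. app ?\<phi> (the_inv_into (Dom ?\<psi>) (app ?\<psi>) a)"
  have CT: "CT \<tau> \<rho> = mk_func {app x \<rho> |x. x \<in> M \<and> \<tau> \<in> Dom x \<and> \<rho> \<in> Dom x}
      {app x \<tau> |x. x \<in> M \<and> \<tau> \<in> Dom x \<and> \<rho> \<in> Dom x} ?h"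
    unfolding cauchy_transformations_def coordinates_transformation_def D im ..
  have h: "?h (app x \<rho>) = app x \<tau>" if "x \<in> M" "\<tau> \<in> Dom x" "\<rho> \<in> Dom x" for x
    using inv[OF that(1,3)] cauchy_chart_sel(2)[OF that(1,2)] by simp
  then have "?h \<in> {app x \<rho> |x. x \<in> M \<and> \<tau> \<in> Dom x \<and> \<rho> \<in> Dom x} \<rightarrow>
      {app x \<tau> |x. x \<in> M \<and> \<tau> \<in> Dom x \<and> \<rho> \<in> Dom x}"
    by blast
  note sel = mk_func_sel[OF this]
  show "Dom (CT \<tau> \<rho>) = {app x \<rho> |x. x \<in> M \<and> \<tau> \<in> Dom x \<and> \<rho> \<in> Dom x}"
    and "Codom (CT \<tau> \<rho>) = {app x \<tau> |x. x \<in> M \<and> \<tau> \<in> Dom x \<and> \<rho> \<in> Dom x}"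
    unfolding CT by (rule sel)+
  show "app (CT \<tau> \<rho>) (app x \<rho>) = app x \<tau>" if "x \<in> M" "\<tau> \<in> Dom x" "\<rho> \<in> Dom x"
    unfolding CT using sel(3)[of "app x \<rho>"] h[OF that] that by auto
qed

lemma CT_DomI: "x \<in> M \<Longrightarrow> \<tau> \<in> Dom x \<Longrightarrow> \<rho> \<in> Dom x \<Longrightarrow> app x \<rho> \<in> Dom (CT \<tau> \<rho>)"
  unfolding cauchy_transformations_sel by blast

lemma CT_DomE:
  assumes "a \<in> Dom (CT \<tau> \<rho>)"
  obtains x where "x \<in> M" "\<tau> \<in> Dom x" "\<rho> \<in> Dom x" "app x \<rho> = a" "app (CT \<tau> \<rho>) a = app x \<tau>"
proof -
  from assms obtain x where x: "x \<in> M" "\<tau> \<in> Dom x" "\<rho> \<in> Dom x" "app x \<rho> = a"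
    unfolding cauchy_transformations_sel(1) by blast
  with that[OF x] cauchy_transformations_sel(3)[OF x(1-3)] show ?thesis by simp
qed

section \<open>Openness of the domain and smoothness of the global flow\<close>

abbreviation "flow \<equiv> \<lambda>(\<tau>, \<rho>, a). app (CT \<tau> \<rho>) a"

definition regular_at :: "real \<Rightarrow> real \<times> (real ^ 'n) \<Rightarrow> bool"
  where "regular_at \<sigma> w \<longleftrightarrow> (\<exists>I N. open I \<and> \<sigma> \<in> I \<and> open N \<and> w \<in> N \<and>
    I \<times> N \<subseteq> total_domain CT \<and> C1_on flow (I \<times> N))"

text \<open>
  For times \<open>\<sigma>\<close>, \<open>\<tau>\<close> close to \<open>\<sigma>'\<close>, the flow to \<open>\<tau>\<close> is the flow to \<open>\<sigma>\<close> followed by the local flow around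
  \<open>(\<sigma>', x0(\<sigma>'))\<close>, so regularity at \<open>\<sigma>\<close> carries over to \<open>\<tau>\<close>.  The neighbourhood \<open>W\<close> does not depend on which
  of its points is known to be regular; this is what makes the set of irregular times open too.
\<close>

lemma regular_at_propagates:
  assumes x0: "x0 \<in> M" "\<rho>0 \<in> Dom x0" "\<sigma>' \<in> Dom x0"
  shows "\<exists>W. open W \<and> \<sigma>' \<in> W \<and> W \<subseteq> Dom x0 \<and>
    (\<forall>\<sigma>\<in>W. \<forall>\<tau>\<in>W. regular_at \<sigma> (\<rho>0, app x0 \<rho>0) \<longrightarrow> regular_at \<tau> (\<rho>0, app x0 \<rho>0))"
proof -
  note sol = solvesD[OF complete_solution_solves[OF x0(1)]]
  obtain e \<Psi> where e: "e > 0"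
    and \<Psi>: "C1_on \<Psi> ({\<sigma>' - e<..<\<sigma>' + e} \<times> {\<sigma>' - e<..<\<sigma>' + e} \<times> ball (app x0 \<sigma>') e)"
      "\<And>\<sigma> a. \<sigma> \<in> {\<sigma>' - e<..<\<sigma>' + e} \<Longrightarrow> a \<in> ball (app x0 \<sigma>') e \<Longrightarrow>
        solves f {\<sigma>' - e<..<\<sigma>' + e} (\<lambda>\<tau>. \<Psi> (\<tau>, \<sigma>, a))"
      "\<And>\<sigma> a. \<sigma> \<in> {\<sigma>' - e<..<\<sigma>' + e} \<Longrightarrow> a \<in> ball (app x0 \<sigma>') e \<Longrightarrow> \<Psi> (\<sigma>, \<sigma>, a) = a"
    using local_solutions[OF sol(3)[OF x0(3)]] by blast
  let ?I = "{\<sigma>' - e<..<\<sigma>' + e}" and ?B = "ball (app x0 \<sigma>') e"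
  let ?w = "(\<rho>0, app x0 \<rho>0)"
  define W where "W = ?I \<inter> (Dom x0 \<inter> app x0 -` ?B)"
  have "open W"
    unfolding W_def by (intro open_Int continuous_open_preimage sol(1,5)) auto
  moreover have "\<sigma>' \<in> W"
    using e x0 by (simp add: W_def)
  moreover have "W \<subseteq> Dom x0"
    by (auto simp: W_def)
  moreover have "regular_at \<tau> ?w" if \<sigma>: "\<sigma> \<in> W" and \<tau>: "\<tau> \<in> W" and reg: "regular_at \<sigma> ?w" for \<sigma> \<tau>
  proof -
    have \<sigma>': "\<sigma> \<in> ?I" "\<sigma> \<in> Dom x0" "app x0 \<sigma> \<in> ?B" and \<tau>': "\<tau> \<in> ?I"
      using \<sigma> \<tau> by (auto simp: W_def)
    obtain I N where I: "open I" "\<sigma> \<in> I" and N: "open N" "?w \<in> N"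
      and sub: "I \<times> N \<subseteq> total_domain CT" and smooth: "C1_on flow (I \<times> N)"
      using reg unfolding regular_at_def by blast
    let ?s = "\<lambda>w. flow (\<sigma>, w)"
    have "C1_on (\<lambda>w. (\<sigma>, w)) N"
      by (rule C1_on_Pair[OF C1_on_const C1_on_bounded_linear[OF bounded_linear_ident]])
    then have s: "C1_on ?s N"
      using I by (intro C1_on_compose[OF smooth]) auto
    define N' where "N' = N \<inter> ?s -` ?B"
    have N': "open N'"
      unfolding N'_def by (intro continuous_open_preimage C1_on_continuous_on[OF s] N(1)) auto
    have "?s ?w = app x0 \<sigma>"
      using cauchy_transformations_sel(3)[OF x0(1) \<sigma>'(2) x0(2)] by simp
    then have w: "?w \<in> N'"
      using N(2) \<sigma>'(3) by (simp add: N'_def)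
    have step: "(t, w) \<in> total_domain CT \<and> flow (t, w) = \<Psi> (t, \<sigma>, ?s w)"
      if t: "t \<in> ?I" and w: "w \<in> N'" for t w
    proof -
      obtain \<rho> a where wa: "w = (\<rho>, a)" by (cases w)
      have "(\<sigma>, \<rho>, a) \<in> total_domain CT"
        using sub I(2) w wa by (auto simp: N'_def)
      then have "a \<in> Dom (CT \<sigma> \<rho>)"
        by (simp add: total_domain_def)
      then obtain x where x: "x \<in> M" "\<sigma> \<in> Dom x" "\<rho> \<in> Dom x" "app x \<rho> = a"
        "app (CT \<sigma> \<rho>) a = app x \<sigma>"
        by (rule CT_DomE)
      have B: "app x \<sigma> \<in> ?B"
        using w x(5) by (simp add: N'_def wa)
      note ext = complete_solution_extends[OF x(1,2) \<Psi>(2)[OF \<sigma>'(1) B] \<sigma>'(1) \<Psi>(3)[OF \<sigma>'(1) B]]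
      have tx: "t \<in> Dom x"
        using ext(1) t by blast
      show ?thesis
        using CT_DomI[OF x(1) tx x(3)] cauchy_transformations_sel(3)[OF x(1) tx x(3)] ext(2)[OF t]
        by (simp add: total_domain_def wa x(4,5))
    qed
    have "C1_on (\<lambda>w. \<Psi> (fst w, \<sigma>, ?s (snd w))) (?I \<times> N')"
    proof (rule C1_on_compose[OF \<Psi>(1)])
      have "C1_on (\<lambda>w::real \<times> real \<times> (real ^ 'n). \<sigma>) (?I \<times> N')"
        by (rule C1_on_const)
      moreover have "C1_on (\<lambda>w. ?s (snd w)) (?I \<times> N')"
        by (rule C1_on_compose[OF s C1_on_bounded_linear[OF bounded_linear_snd]])
          (auto simp: N'_def)
      ultimately show "C1_on (\<lambda>w. (fst w, \<sigma>, ?s (snd w))) (?I \<times> N')"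
        by (intro C1_on_Pair C1_on_bounded_linear[OF bounded_linear_fst])
      show "(\<lambda>w. (fst w, \<sigma>, ?s (snd w))) ` (?I \<times> N') \<subseteq> ?I \<times> ?I \<times> ?B"
        using \<sigma>'(1) by (auto simp: N'_def)
    qed
    then have "C1_on flow (?I \<times> N')"
    proof (rule C1_on_cong)
      show "flow w = \<Psi> (fst w, \<sigma>, ?s (snd w))" if "w \<in> ?I \<times> N'" for w
        using step[of "fst w" "snd w"] that by auto
    qed (intro open_Times open_greaterThanLessThan N')
    moreover have "?I \<times> N' \<subseteq> total_domain CT"
      using step by auto
    ultimately show ?thesis
      unfolding regular_at_def
      by (intro exI[of _ ?I] exI[of _ N'] conjI open_greaterThanLessThan \<tau>' N' w)
  qed
  ultimately show ?thesis by blast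
qed

lemma regular_at_initial:
  assumes x0: "x0 \<in> M" "\<rho>0 \<in> Dom x0"
  shows "regular_at \<rho>0 (\<rho>0, app x0 \<rho>0)"
proof -
  note sol = solvesD[OF complete_solution_solves[OF x0(1)]]
  obtain e \<Psi> where e: "e > 0"
    and \<Psi>: "C1_on \<Psi> ({\<rho>0 - e<..<\<rho>0 + e} \<times> {\<rho>0 - e<..<\<rho>0 + e} \<times> ball (app x0 \<rho>0) e)"
      "\<And>\<sigma> a. \<sigma> \<in> {\<rho>0 - e<..<\<rho>0 + e} \<Longrightarrow> a \<in> ball (app x0 \<rho>0) e \<Longrightarrow>
        solves f {\<rho>0 - e<..<\<rho>0 + e} (\<lambda>\<tau>. \<Psi> (\<tau>, \<sigma>, a))"
      "\<And>\<sigma> a. \<sigma> \<in> {\<rho>0 - e<..<\<rho>0 + e} \<Longrightarrow> a \<in> ball (app x0 \<rho>0) e \<Longrightarrow> \<Psi> (\<sigma>, \<sigma>, a) = a"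
    using local_solutions[OF sol(3)[OF x0(2)]] by blast
  let ?I = "{\<rho>0 - e<..<\<rho>0 + e}" and ?B = "ball (app x0 \<rho>0) e"
  have step: "(t, \<rho>, a) \<in> total_domain CT \<and> flow (t, \<rho>, a) = \<Psi> (t, \<rho>, a)"
    if t: "t \<in> ?I" "\<rho> \<in> ?I" "a \<in> ?B" for t \<rho> a
  proof -
    obtain x where x: "x \<in> M" "?I \<subseteq> Dom x" "\<And>s. s \<in> ?I \<Longrightarrow> app x s = \<Psi> (s, \<rho>, a)"
      using complete_solution_exists[OF \<Psi>(2)[OF t(2,3)] t(2)] by metis
    have d: "t \<in> Dom x" "\<rho> \<in> Dom x" and a: "app x \<rho> = a"
      using x(2) t x(3)[OF t(2)] \<Psi>(3)[OF t(2,3)] by auto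
    show ?thesis
      using CT_DomI[OF x(1) d] cauchy_transformations_sel(3)[OF x(1) d] x(3)[OF t(1)]
      by (simp add: total_domain_def a)
  qed
  have "C1_on flow (?I \<times> ?I \<times> ?B)"
  proof (rule C1_on_cong[OF \<Psi>(1)])
    show "open (?I \<times> ?I \<times> ?B)"
      by (intro open_Times open_greaterThanLessThan open_ball)
    show "flow w = \<Psi> w" if "w \<in> ?I \<times> ?I \<times> ?B" for w
      using that step by (cases w) auto
  qed
  moreover have "?I \<times> ?I \<times> ?B \<subseteq> total_domain CT"
    using step by auto
  moreover have "open ?I" "open (?I \<times> ?B)" "\<rho>0 \<in> ?I" "(\<rho>0, app x0 \<rho>0) \<in> ?I \<times> ?B"
    using e by (auto intro!: open_Times)
  ultimately show ?thesis
    unfolding regular_at_def by (intro exI[of _ ?I] exI[of _ "?I \<times> ?B"] conjI)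
qed

text \<open>
  By the previous two lemmas the regular times form a non-empty open and closed part of the
  connected domain of the solution.
\<close>

lemma regular_everywhere:
  assumes x0: "x0 \<in> M" "\<rho>0 \<in> Dom x0" "\<tau> \<in> Dom x0"
  shows "regular_at \<tau> (\<rho>0, app x0 \<rho>0)"
proof (rule ccontr)
  assume neg: "\<not> ?thesis"
  let ?R = "\<lambda>\<sigma>. regular_at \<sigma> (\<rho>0, app x0 \<rho>0)"
  let ?G = "{\<sigma> \<in> Dom x0. ?R \<sigma>}" and ?N = "{\<sigma> \<in> Dom x0. \<not> ?R \<sigma>}"
  note W = regular_at_propagates[OF x0(1,2)]
  have "\<exists>W. open W \<and> \<sigma> \<in> W \<and> W \<subseteq> ?G" if "\<sigma> \<in> ?G" for \<sigma>
    using W[of \<sigma>] that by blast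
  then have "open ?G"
    by (rule Topological_Spaces.openI)
  moreover have "\<exists>W. open W \<and> \<sigma> \<in> W \<and> W \<subseteq> ?N" if "\<sigma> \<in> ?N" for \<sigma>
    using W[of \<sigma>] that by blast
  then have "open ?N"
    by (rule Topological_Spaces.openI)
  moreover have "connected (Dom x0)"
    using solvesD(2)[OF complete_solution_solves[OF x0(1)]] by (simp add: is_interval_connected)
  ultimately have "?G \<inter> Dom x0 = {} \<or> ?N \<inter> Dom x0 = {}"
    by (intro connectedD) auto
  then show False
    using neg x0 regular_at_initial[OF x0(1,2)] by blast
qed

lemma flow_regular:
  shows "open (total_domain CT)" and "C1_on flow (total_domain CT)"
proof -
  have *: "\<exists>V. open V \<and> p \<in> V \<and> V \<subseteq> total_domain CT \<and> C1_on flow V"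
    if p: "p \<in> total_domain CT" for p
  proof -
    obtain \<tau> \<rho> a where p': "p = (\<tau>, \<rho>, a)" "a \<in> Dom (CT \<tau> \<rho>)"
      using p by (auto simp: total_domain_def)
    from p'(2) obtain x where x: "x \<in> M" "\<tau> \<in> Dom x" "\<rho> \<in> Dom x" "app x \<rho> = a"
      by (rule CT_DomE)
    from regular_everywhere[OF x(1,3,2)] obtain I N where "open I" "\<tau> \<in> I" "open N" "(\<rho>, a) \<in> N"
      "I \<times> N \<subseteq> total_domain CT" "C1_on flow (I \<times> N)"
      unfolding regular_at_def x(4) by blast
    then show ?thesis
      using p'(1) by (intro exI[of _ "I \<times> N"]) (auto intro: open_Times)
  qed
  show "open (total_domain CT)"
    by (rule Topological_Spaces.openI) (use * in blast)
  show "C1_on flow (total_domain CT)"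
    by (rule C1_on_local) (use * in blast)
qed

end

section \<open>Properties of the coordinates transformations of a Cauchy atlas\<close>

context C1_field
begin

lemma flow_vector_derivative:
  assumes "a \<in> Dom (CT \<tau> \<rho>)"
  shows "(\<tau>, app (CT \<tau> \<rho>) a) \<in> Dom f"
    and "((\<lambda>s. app (CT s \<rho>) a) has_vector_derivative app f (\<tau>, app (CT \<tau> \<rho>) a)) (at \<tau>)"
proof -
  obtain x where x: "x \<in> M" "\<tau> \<in> Dom x" "\<rho> \<in> Dom x" "app x \<rho> = a" "app (CT \<tau> \<rho>) a = app x \<tau>"
    using assms by (rule CT_DomE)
  note sol = solvesD[OF complete_solution_solves[OF x(1)]]
  show "(\<tau>, app (CT \<tau> \<rho>) a) \<in> Dom f"
    unfolding x(5) by (rule sol(3)[OF x(2)])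
  show "((\<lambda>s. app (CT s \<rho>) a) has_vector_derivative app f (\<tau>, app (CT \<tau> \<rho>) a)) (at \<tau>)"
    unfolding x(5)
  proof (rule has_vector_derivative_transform_within_open[OF sol(4)[OF x(2)] sol(1) x(2)])
    show "app x s = app (CT s \<rho>) a" if "s \<in> Dom x" for s
      using cauchy_transformations_sel(3)[OF x(1) that x(3)] x(4) by simp
  qed
qed

lemma CT_total_domain_nonempty:
  assumes "Dom f \<noteq> {}"
  shows "total_domain CT \<noteq> {}"
proof -
  obtain \<tau> a where w: "(\<tau>, a) \<in> Dom f"
    using assms by auto
  obtain e \<Psi> where e: "e > 0"
    and "C1_on \<Psi> ({\<tau> - e<..<\<tau> + e} \<times> {\<tau> - e<..<\<tau> + e} \<times> ball a e)"
    and \<Psi>: "\<And>\<sigma> b. \<sigma> \<in> {\<tau> - e<..<\<tau> + e} \<Longrightarrow> b \<in> ball a e \<Longrightarrow>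
      solves f {\<tau> - e<..<\<tau> + e} (\<lambda>t. \<Psi> (t, \<sigma>, b))"
    and "\<And>\<sigma> b. \<sigma> \<in> {\<tau> - e<..<\<tau> + e} \<Longrightarrow> b \<in> ball a e \<Longrightarrow> \<Psi> (\<sigma>, \<sigma>, b) = b"
    using local_solutions[OF w] by blast
  have \<tau>: "\<tau> \<in> {\<tau> - e<..<\<tau> + e}" "a \<in> ball a e"
    using e by auto
  obtain x where "x \<in> M" "{\<tau> - e<..<\<tau> + e} \<subseteq> Dom x"
    "\<And>s. s \<in> {\<tau> - e<..<\<tau> + e} \<Longrightarrow> app x s = \<Psi> (s, \<tau>, a)"
    using complete_solution_exists[OF \<Psi>[OF \<tau>] \<tau>(1)] by metis
  then have "app x \<tau> \<in> Dom (CT \<tau> \<tau>)"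
    using \<tau>(1) by (intro CT_DomI) blast+
  then show ?thesis
    by (auto simp: total_domain_def)
qed

lemma CT_bijection: "is_bijection (CT \<tau> \<rho>)"
  unfolding is_bijection_def bij_betw_def
proof
  show "inj_on (app (CT \<tau> \<rho>)) (Dom (CT \<tau> \<rho>))"
  proof (rule inj_onI)
    fix a b assume ab: "a \<in> Dom (CT \<tau> \<rho>)" "b \<in> Dom (CT \<tau> \<rho>)" "app (CT \<tau> \<rho>) a = app (CT \<tau> \<rho>) b"
    obtain x where x: "x \<in> M" "\<tau> \<in> Dom x" "\<rho> \<in> Dom x" "app x \<rho> = a" "app (CT \<tau> \<rho>) a = app x \<tau>"
      using ab(1) by (rule CT_DomE)
    obtain y where y: "y \<in> M" "\<tau> \<in> Dom y" "\<rho> \<in> Dom y" "app y \<rho> = b" "app (CT \<tau> \<rho>) b = app y \<tau>"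
      using ab(2) by (rule CT_DomE)
    have "x = y"
      using complete_solution_unique[OF x(1) y(1) x(2) y(2)] ab(3) x(5) y(5) by simp
    then show "a = b"
      using x(4) y(4) by simp
  qed
  show "app (CT \<tau> \<rho>) ` Dom (CT \<tau> \<rho>) = Codom (CT \<tau> \<rho>)"
  proof (intro equalityI subsetI)
    fix b assume "b \<in> app (CT \<tau> \<rho>) ` Dom (CT \<tau> \<rho>)"
    then obtain a where a: "a \<in> Dom (CT \<tau> \<rho>)" "b = app (CT \<tau> \<rho>) a"
      by blast
    from a(1) obtain x where "x \<in> M" "\<tau> \<in> Dom x" "\<rho> \<in> Dom x" "app (CT \<tau> \<rho>) a = app x \<tau>"
      by (rule CT_DomE)
    then show "b \<in> Codom (CT \<tau> \<rho>)"
      unfolding cauchy_transformations_sel(2) a(2) by blast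
  next
    fix b assume "b \<in> Codom (CT \<tau> \<rho>)"
    then obtain x where x: "x \<in> M" "\<tau> \<in> Dom x" "\<rho> \<in> Dom x" "b = app x \<tau>"
      unfolding cauchy_transformations_sel(2) by blast
    show "b \<in> app (CT \<tau> \<rho>) ` Dom (CT \<tau> \<rho>)"
      using CT_DomI[OF x(1-3)] cauchy_transformations_sel(3)[OF x(1-3)] x(4) by (metis image_eqI)
  qed
qed

lemma CT_interval: "open_interval {\<tau>. a \<in> Dom (CT \<tau> \<rho>)}"
proof (cases "\<exists>x\<in>M. \<rho> \<in> Dom x \<and> app x \<rho> = a")
  case True
  then obtain x where x: "x \<in> M" "\<rho> \<in> Dom x" "app x \<rho> = a"
    by blast
  have "{\<tau>. a \<in> Dom (CT \<tau> \<rho>)} = Dom x"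
  proof (intro equalityI subsetI)
    fix \<tau> assume "\<tau> \<in> {\<tau>. a \<in> Dom (CT \<tau> \<rho>)}"
    then have "a \<in> Dom (CT \<tau> \<rho>)" by simp
    then obtain y where y: "y \<in> M" "\<tau> \<in> Dom y" "\<rho> \<in> Dom y" "app y \<rho> = a"
      by (rule CT_DomE)
    then have "x = y"
      using complete_solution_unique[OF x(1) y(1) x(2) y(3)] x(3) by simp
    then show "\<tau> \<in> Dom x"
      using y(2) by simp
  next
    fix \<tau> assume "\<tau> \<in> Dom x"
    then show "\<tau> \<in> {\<tau>. a \<in> Dom (CT \<tau> \<rho>)}"
      using CT_DomI[OF x(1) _ x(2)] x(3) by simp
  qed
  then show ?thesis
    using complete_solution_solves[OF x(1)] by (simp add: solves_def)
next
  case False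
  have "a \<notin> Dom (CT \<tau> \<rho>)" for \<tau>
    using False unfolding cauchy_transformations_sel(1) by blast
  then show ?thesis
    by (simp add: open_interval_def is_interval_empty)
qed

lemma CT_cocycle:
  assumes a: "a \<in> Dom (CT \<sigma> \<rho>)" "app (CT \<sigma> \<rho>) a \<in> Codom (CT \<sigma> \<tau>)"
  shows "app (CT \<sigma> \<rho>) a \<in> Dom (CT \<tau> \<sigma>)" "a \<in> Dom (CT \<tau> \<rho>)"
    "app (CT \<tau> \<sigma>) (app (CT \<sigma> \<rho>) a) = app (CT \<tau> \<rho>) a"
proof -
  obtain x where x: "x \<in> M" "\<sigma> \<in> Dom x" "\<rho> \<in> Dom x" "app x \<rho> = a" "app (CT \<sigma> \<rho>) a = app x \<sigma>"
    using a(1) by (rule CT_DomE)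
  obtain y where y: "y \<in> M" "\<sigma> \<in> Dom y" "\<tau> \<in> Dom y" "app (CT \<sigma> \<rho>) a = app y \<sigma>"
    using a(2) unfolding cauchy_transformations_sel(2) by blast
  have "x = y"
    using complete_solution_unique[OF x(1) y(1) x(2) y(2)] x(5) y(4) by simp
  then have \<tau>: "\<tau> \<in> Dom x"
    using y(3) by simp
  show "app (CT \<sigma> \<rho>) a \<in> Dom (CT \<tau> \<sigma>)"
    unfolding x(5) by (rule CT_DomI[OF x(1) \<tau> x(2)])
  show "a \<in> Dom (CT \<tau> \<rho>)"
    unfolding x(4)[symmetric] by (rule CT_DomI[OF x(1) \<tau> x(3)])
  show "app (CT \<tau> \<sigma>) (app (CT \<sigma> \<rho>) a) = app (CT \<tau> \<rho>) a"
    unfolding x(5) using cauchy_transformations_sel(3)[OF x(1) \<tau> x(2)]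
      cauchy_transformations_sel(3)[OF x(1) \<tau> x(3)] x(4) by simp
qed

lemma CT_tau_derivative:
  assumes "(\<tau>, \<rho>, a) \<in> total_domain CT"
  shows "tau_derivative CT (\<tau>, \<rho>, a) = app f (\<tau>, app (CT \<tau> \<rho>) a)"
  using flow_vector_derivative(2)[of a \<tau> \<rho>] assms
  by (simp add: tau_derivative_def total_domain_def vector_derivative_at)

text \<open>
  By the differential equation the derivative in \<open>\<tau>\<close> is the field composed with the flow, which are
  both continuously differentiable.
\<close>

lemma CT_tau_derivative_C1: "C1_on (tau_derivative CT) (total_domain CT)"
proof (rule C1_on_cong)
  have "C1_on (\<lambda>w. (fst w, flow w)) (total_domain CT)"
    by (intro C1_on_Pair C1_on_bounded_linear[OF bounded_linear_fst] flow_regular(2))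
  then show "C1_on (\<lambda>w. app f (fst w, flow w)) (total_domain CT)"
  proof (rule C1_on_compose[OF C1], intro image_subsetI)
    fix w assume "w \<in> total_domain CT"
    then show "(fst w, flow w) \<in> Dom f"
      using flow_vector_derivative(1) by (cases w) (auto simp: total_domain_def)
  qed
  show "open (total_domain CT)"
    by (rule flow_regular(1))
  show "tau_derivative CT w = app f (fst w, flow w)" if "w \<in> total_domain CT" for w
    using CT_tau_derivative that by (cases w) auto
qed

end

section \<open>Recovering the differential equation from its coordinates transformations\<close>

text \<open>
  The velocity at \<open>(\<tau>, a)\<close> is read off from the orbit that starts there; the pairs at which this is
  possible are those with \<open>a\<close> in the domain of \<open>F\<^sub>\<tau>\<^sub>\<tau>\<close>.
\<close>

definition evolution_field ::
    "(real \<Rightarrow> real \<Rightarrow> (real ^ 'n::finite, real ^ 'n) func) \<Rightarrow> 'n vector_field"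
  where "evolution_field F =
    mk_func {(\<tau>, a). a \<in> Dom (F \<tau> \<tau>)} UNIV (\<lambda>(\<tau>, a). tau_derivative F (\<tau>, \<tau>, a))"

lemma evolution_field_sel:
  shows "Dom (evolution_field F) = {(\<tau>, a). a \<in> Dom (F \<tau> \<tau>)}"
    and "Codom (evolution_field F) = UNIV"
    and "a \<in> Dom (F \<tau> \<tau>) \<Longrightarrow> app (evolution_field F) (\<tau>, a) = tau_derivative F (\<tau>, \<tau>, a)"
proof -
  have "(\<lambda>(\<tau>, a). tau_derivative F (\<tau>, \<tau>, a)) \<in> {(\<tau>, a). a \<in> Dom (F \<tau> \<tau>)} \<rightarrow> UNIV"
    by simp
  note sel = mk_func_sel[OF this, folded evolution_field_def]
  show "Dom (evolution_field F) = {(\<tau>, a). a \<in> Dom (F \<tau> \<tau>)}" "Codom (evolution_field F) = UNIV"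
    by (rule sel)+
  show "a \<in> Dom (F \<tau> \<tau>) \<Longrightarrow> app (evolution_field F) (\<tau>, a) = tau_derivative F (\<tau>, \<tau>, a)"
    using sel(3)[of "(\<tau>, a)"] by simp
qed

locale transformation_system =
  fixes F :: "real \<Rightarrow> real \<Rightarrow> (real ^ 'n::finite, real ^ 'n) func"
  assumes open_total_domain: "open (total_domain F)"
    and bijection: "is_bijection (F \<tau> \<rho>)"
    and differentiable: "a \<in> Dom (F \<tau> \<rho>) \<Longrightarrow> (\<lambda>s. app (F s \<rho>) a) differentiable (at \<tau>)"
    and tau_derivative_C1: "C1_on (tau_derivative F) (total_domain F)"
    and interval: "open_interval {\<tau>. a \<in> Dom (F \<tau> \<rho>)}"
    and cocycle: "a \<in> Dom (F \<sigma> \<rho>) \<Longrightarrow> app (F \<sigma> \<rho>) a \<in> Codom (F \<sigma> \<tau>) \<Longrightarrow>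
      app (F \<sigma> \<rho>) a \<in> Dom (F \<tau> \<sigma>) \<and> a \<in> Dom (F \<tau> \<rho>) \<and>
      app (F \<tau> \<sigma>) (app (F \<sigma> \<rho>) a) = app (F \<tau> \<rho>) a"
begin

lemma image_Dom: "app (F \<tau> \<rho>) ` Dom (F \<tau> \<rho>) = Codom (F \<tau> \<rho>)"
  using bijection by (simp add: is_bijection_def bij_betw_def)

lemma app_in_Codom: "a \<in> Dom (F \<tau> \<rho>) \<Longrightarrow> app (F \<tau> \<rho>) a \<in> Codom (F \<tau> \<rho>)"
  using image_Dom by blast

lemma round_trip:
  assumes "a \<in> Dom (F \<sigma> \<rho>)"
  shows "app (F \<sigma> \<rho>) a \<in> Dom (F \<rho> \<sigma>)" "a \<in> Dom (F \<rho> \<rho>)"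
    "app (F \<rho> \<sigma>) (app (F \<sigma> \<rho>) a) = app (F \<rho> \<rho>) a"
  using cocycle[OF assms app_in_Codom[OF assms]] by blast+

text \<open>
  By the cocycle condition \<open>F\<^sub>\<rho>\<^sub>\<rho>\<close> is idempotent, and an injective idempotent map is the identity.
\<close>

lemma identity: "a \<in> Dom (F \<rho> \<rho>) \<Longrightarrow> app (F \<rho> \<rho>) a = a"
  using round_trip[of a \<rho> \<rho>] bijection[of \<rho> \<rho>]
  by (auto simp: is_bijection_def bij_betw_def dest: inj_onD)

lemma Codom_eq_Dom: "Codom (F \<sigma> \<rho>) = Dom (F \<rho> \<sigma>)"
proof (intro equalityI subsetI)
  fix b assume "b \<in> Codom (F \<sigma> \<rho>)"
  then obtain a where "a \<in> Dom (F \<sigma> \<rho>)" "b = app (F \<sigma> \<rho>) a"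
    using image_Dom by blast
  then show "b \<in> Dom (F \<rho> \<sigma>)"
    using round_trip(1) by blast
next
  fix b assume b: "b \<in> Dom (F \<rho> \<sigma>)"
  note r = round_trip[OF b]
  have "app (F \<sigma> \<rho>) (app (F \<rho> \<sigma>) b) = b"
    using r(3) identity[OF r(2)] by simp
  then show "b \<in> Codom (F \<sigma> \<rho>)"
    using app_in_Codom[OF r(1)] by simp
qed

lemma composition:
  assumes "a \<in> Dom (F \<sigma> \<rho>)" "app (F \<sigma> \<rho>) a \<in> Dom (F \<tau> \<sigma>)"
  shows "app (F \<tau> \<sigma>) (app (F \<sigma> \<rho>) a) = app (F \<tau> \<rho>) a"
  using cocycle[OF assms(1), of \<tau>] assms(2) by (simp add: Codom_eq_Dom)

lemma app_in_diagonal_Dom: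
  assumes "a \<in> Dom (F \<tau> \<rho>)"
  shows "app (F \<tau> \<rho>) a \<in> Dom (F \<tau> \<tau>)"
  by (rule round_trip(2)[OF round_trip(1)[OF assms]])

abbreviation "f \<equiv> evolution_field F"

lemma diagonal_C1: "C1_on (\<lambda>w. (fst w, fst w, snd w)) (U :: (real \<times> (real ^ 'n)) set)"
  by (intro C1_on_Pair C1_on_bounded_linear bounded_linear_fst bounded_linear_snd)

lemma Dom_field_eq: "Dom f = (\<lambda>w. (fst w, fst w, snd w)) -` total_domain F"
  by (auto simp: evolution_field_sel total_domain_def)

sublocale C1_field f
proof
  show "open (Dom f)"
    unfolding Dom_field_eq
    by (intro open_vimage open_total_domain C1_on_continuous_on[OF diagonal_C1])
  then show "C1_on (app f) (Dom f)"
  proof (rule C1_on_cong[rotated])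
    show "C1_on (\<lambda>w. tau_derivative F (fst w, fst w, snd w)) (Dom f)"
      by (rule C1_on_compose[OF tau_derivative_C1 diagonal_C1]) (auto simp: Dom_field_eq)
    show "app f w = tau_derivative F (fst w, fst w, snd w)" if "w \<in> Dom f" for w
      using evolution_field_sel(3)[of "snd w" F "fst w"] that
      by (cases w) (simp add: evolution_field_sel(1))
  qed
qed

lemma orbit_solves: "solves f {\<tau>. a \<in> Dom (F \<tau> \<rho>)} (\<lambda>\<tau>. app (F \<tau> \<rho>) a)"
  unfolding solves_def
proof (intro conjI ballI)
  show "open_interval {\<tau>. a \<in> Dom (F \<tau> \<rho>)}"
    by (rule interval)
  fix \<tau> assume "\<tau> \<in> {\<tau>. a \<in> Dom (F \<tau> \<rho>)}"
  then have a: "a \<in> Dom (F \<tau> \<rho>)" by simp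
  define b where "b = app (F \<tau> \<rho>) a"
  have b: "b \<in> Dom (F \<tau> \<tau>)"
    unfolding b_def by (rule app_in_diagonal_Dom[OF a])
  then show "(\<tau>, app (F \<tau> \<rho>) a) \<in> Dom f"
    by (simp add: evolution_field_sel b_def)
  \<comment> \<open>Near \<open>\<tau>\<close> the orbit of \<open>a\<close> is the orbit of its value \<open>b\<close> at \<open>\<tau>\<close>.\<close>
  have "((\<lambda>s. app (F s \<tau>) b) has_vector_derivative vector_derivative (\<lambda>s. app (F s \<tau>) b) (at \<tau>)) (at \<tau>)"
    using differentiable[OF b] by (simp add: vector_derivative_works)
  then have "((\<lambda>s. app (F s \<tau>) b) has_vector_derivative app f (\<tau>, b)) (at \<tau>)"
    by (simp add: evolution_field_sel(3)[of b F \<tau>, OF b] tau_derivative_def)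
  then show "((\<lambda>\<tau>. app (F \<tau> \<rho>) a) has_vector_derivative app f (\<tau>, app (F \<tau> \<rho>) a)) (at \<tau>)"
    unfolding b_def[symmetric]
  proof (rule has_vector_derivative_transform_within_open)
    show "open {s. b \<in> Dom (F s \<tau>)}"
      using interval by (simp add: open_interval_def)
    show "\<tau> \<in> {s. b \<in> Dom (F s \<tau>)}"
      using b by simp
    show "app (F s \<tau>) b = app (F s \<rho>) a" if "s \<in> {s. b \<in> Dom (F s \<tau>)}" for s
      using composition[OF a, of s] that by (simp add: b_def)
  qed
qed

text \<open>
  Let the solution be defined at \<open>\<beta>\<close>, outside the domain of the orbit of \<open>a\<close>.  Close to \<open>\<beta>\<close> the
  solution is the orbit of its value \<open>x \<beta>\<close>.  If the orbit of \<open>a\<close> were defined at such a close time \<open>s\<close>, the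
  two orbits would meet there, and the cocycle condition would continue the orbit of \<open>a\<close> to \<open>\<beta>\<close>.
  So the exceptional times form an open set, and connectedness leaves none.
\<close>

lemma orbit_maximal:
  assumes a: "a \<in> Dom (F \<rho> \<rho>)" and x: "solves f I x" "\<rho> \<in> I" "x \<rho> = a"
  shows "I \<subseteq> {\<tau>. a \<in> Dom (F \<tau> \<rho>)}"
proof -
  let ?J = "{\<tau>. a \<in> Dom (F \<tau> \<rho>)}"
  note sol = solvesD[OF x(1)]
  have J: "x s = app (F s \<rho>) a" if "s \<in> I" "s \<in> ?J" for s
    by (rule solves_unique[OF x(1) orbit_solves x(2) _ _ that]) (use a x(3) identity in simp_all)
  have reach: "\<exists>W. open W \<and> \<beta> \<in> W \<and> W \<subseteq> I - ?J" if "\<beta> \<in> I - ?J" for \<beta>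
  proof -
    have \<beta>: "\<beta> \<in> I" "a \<notin> Dom (F \<beta> \<rho>)"
      using that by auto
    have x\<beta>: "x \<beta> \<in> Dom (F \<beta> \<beta>)"
      using sol(3)[OF \<beta>(1)] by (simp add: evolution_field_sel)
    let ?Z = "{s. x \<beta> \<in> Dom (F s \<beta>)}"
    have "s \<notin> ?J" if s: "s \<in> I" "s \<in> ?Z" for s
    proof
      assume "s \<in> ?J"
      have "x s = app (F s \<beta>) (x \<beta>)"
        by (rule solves_unique[OF x(1) orbit_solves \<beta>(1) _ _ s]) (use x\<beta> identity in simp_all)
      then have "app (F s \<rho>) a \<in> Codom (F s \<beta>)"
        using J[OF s(1) \<open>s \<in> ?J\<close>] app_in_Codom[of "x \<beta>" s \<beta>] s(2) by simp
      then show False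
        using cocycle[of a s \<rho> \<beta>] \<open>s \<in> ?J\<close> \<beta>(2) by simp
    qed
    moreover have "open ?Z"
      using interval by (simp add: open_interval_def)
    ultimately show ?thesis
      using sol(1) \<beta>(1) x\<beta> by (intro exI[of _ "I \<inter> ?Z"]) (auto intro: open_Int)
  qed
  have "open (I - ?J)"
    by (rule Topological_Spaces.openI[OF reach])
  moreover have "open (I \<inter> ?J)"
    using sol(1) interval by (simp add: open_interval_def open_Int)
  moreover have "connected I"
    using sol(2) by (simp add: is_interval_connected)
  ultimately have "(I - ?J) \<inter> I = {} \<or> (I \<inter> ?J) \<inter> I = {}"
    by (intro connectedD) auto
  then show ?thesis
    using a x(2) by blast
qed

lemma orbit_complete:
  assumes a: "a \<in> Dom (F \<rho> \<rho>)"
  obtains y where "y \<in> M" "Dom y = {\<tau>. a \<in> Dom (F \<tau> \<rho>)}"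
    "\<And>\<tau>. \<tau> \<in> Dom y \<Longrightarrow> app y \<tau> = app (F \<tau> \<rho>) a"
proof -
  let ?J = "{\<tau>. a \<in> Dom (F \<tau> \<rho>)}" and ?X = "\<lambda>\<tau>. app (F \<tau> \<rho>) a"
  let ?y = "mk_func ?J UNIV ?X"
  have "?X \<in> ?J \<rightarrow> UNIV" by simp
  note sel = mk_func_sel[OF this]
  have \<rho>: "\<rho> \<in> ?J" using a by simp
  have "?y \<in> M"
  proof (rule complete_solutionI)
    show "is_solution f ?y"
      by (rule is_solution_mk_func[OF orbit_solves]) (use \<rho> in blast)
    show "\<rho> \<in> Dom ?y"
      using \<rho> unfolding sel(1) .
    show "I \<subseteq> Dom ?y" if "solves f I x" "\<rho> \<in> I" "x \<rho> = app ?y \<rho>" for I x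
      using orbit_maximal[OF a that(1,2)] that(3) sel(3)[OF \<rho>] identity[OF a]
      unfolding sel(1) by simp
  qed
  then show ?thesis
    using that[of ?y] sel by simp
qed

lemma complete_solution_is_orbit:
  assumes x: "x \<in> M" "\<rho> \<in> Dom x"
  shows "app x \<rho> \<in> Dom (F \<tau> \<rho>) \<longleftrightarrow> \<tau> \<in> Dom x"
    and "\<tau> \<in> Dom x \<Longrightarrow> app x \<tau> = app (F \<tau> \<rho>) (app x \<rho>)"
proof -
  have a: "app x \<rho> \<in> Dom (F \<rho> \<rho>)"
    using solvesD(3)[OF complete_solution_solves[OF x(1)] x(2)] by (simp add: evolution_field_sel)
  obtain y where y: "y \<in> M" "Dom y = {\<tau>. app x \<rho> \<in> Dom (F \<tau> \<rho>)}"
    "\<And>\<tau>. \<tau> \<in> Dom y \<Longrightarrow> app y \<tau> = app (F \<tau> \<rho>) (app x \<rho>)"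
    using orbit_complete[OF a] by blast
  have "\<rho> \<in> Dom y"
    using a y(2) by simp
  moreover have "app x \<rho> = app y \<rho>"
    using y(3)[OF \<open>\<rho> \<in> Dom y\<close>] identity[OF a] by simp
  ultimately have xy: "x = y"
    using complete_solution_unique[OF x(1) y(1) x(2)] by blast
  show "app x \<rho> \<in> Dom (F \<tau> \<rho>) \<longleftrightarrow> \<tau> \<in> Dom x"
    using y(2) unfolding xy[symmetric] by blast
  show "\<tau> \<in> Dom x \<Longrightarrow> app x \<tau> = app (F \<tau> \<rho>) (app x \<rho>)"
    using y(3)[of \<tau>] unfolding xy[symmetric] .
qed

lemma transformations_of_evolution_field: "F \<tau> \<rho> = CT \<tau> \<rho>"
proof -
  have ex: "\<exists>x\<in>M. \<tau> \<in> Dom x \<and> \<rho> \<in> Dom x \<and> app x \<rho> = a" if a: "a \<in> Dom (F \<tau> \<rho>)" for a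
  proof -
    have a': "a \<in> Dom (F \<rho> \<rho>)"
      by (rule round_trip(2)[OF a])
    obtain y where y: "y \<in> M" "Dom y = {\<tau>. a \<in> Dom (F \<tau> \<rho>)}"
      "\<And>\<tau>. \<tau> \<in> Dom y \<Longrightarrow> app y \<tau> = app (F \<tau> \<rho>) a"
      using orbit_complete[OF a'] by blast
    have "\<tau> \<in> Dom y" "\<rho> \<in> Dom y"
      using a a' y(2) by simp_all
    moreover have "app y \<rho> = a"
      using y(3)[OF \<open>\<rho> \<in> Dom y\<close>] identity[OF a'] by simp
    ultimately show ?thesis
      using y(1) by blast
  qed
  have D: "Dom (CT \<tau> \<rho>) = Dom (F \<tau> \<rho>)"
  proof (intro equalityI subsetI)
    fix a assume "a \<in> Dom (CT \<tau> \<rho>)"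
    then obtain x where x: "x \<in> M" "\<tau> \<in> Dom x" "\<rho> \<in> Dom x" "app x \<rho> = a"
      by (rule CT_DomE)
    then show "a \<in> Dom (F \<tau> \<rho>)"
      using complete_solution_is_orbit(1)[OF x(1,3)] by blast
  next
    fix a assume "a \<in> Dom (F \<tau> \<rho>)"
    from ex[OF this] obtain x where "x \<in> M" "\<tau> \<in> Dom x" "\<rho> \<in> Dom x" "app x \<rho> = a"
      by blast
    then show "a \<in> Dom (CT \<tau> \<rho>)"
      using CT_DomI[of x \<tau> \<rho>] by simp
  qed
  have A: "app (CT \<tau> \<rho>) a = app (F \<tau> \<rho>) a" if a: "a \<in> Dom (F \<tau> \<rho>)" for a
  proof -
    obtain x where x: "x \<in> M" "\<tau> \<in> Dom x" "\<rho> \<in> Dom x" "app x \<rho> = a"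
      using ex[OF a] by blast
    then show ?thesis
      using cauchy_transformations_sel(3)[OF x(1-3)] complete_solution_is_orbit(2)[OF x(1,3,2)] by simp
  qed
  have "Codom (CT \<tau> \<rho>) = app (CT \<tau> \<rho>) ` Dom (CT \<tau> \<rho>)"
    using CT_bijection[of \<tau> \<rho>] by (simp add: is_bijection_def bij_betw_def)
  also have "\<dots> = app (F \<tau> \<rho>) ` Dom (F \<tau> \<rho>)"
    unfolding D by (rule image_cong[OF refl A])
  finally have "Codom (CT \<tau> \<rho>) = Codom (F \<tau> \<rho>)"
    by (simp add: image_Dom)
  with D A show ?thesis
    by (simp add: func_eq_iff)
qed

end

section \<open>Characterization of the coordinates transformations of Cauchy atlases\<close>

theorem mainTheorem1:
  fixes F :: "real \<Rightarrow> real \<Rightarrow> (real ^ 'n::finite, real ^ 'n) func"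
  shows
    "(\<exists>f :: 'n vector_field.
        open (Dom f) \<and> Dom f \<noteq> {} \<and> Codom f = UNIV \<and> C1_on (app f) (Dom f) \<and>
        (\<forall>\<tau> \<rho>. F \<tau> \<rho> = cauchy_transformations f \<tau> \<rho>))
     \<longleftrightarrow>
     (open (total_domain F) \<and> total_domain F \<noteq> {}) \<and>
     (\<forall>\<tau> \<rho>. is_bijection (F \<tau> \<rho>)) \<and>
     ((\<forall>(\<tau>, \<rho>, a) \<in> total_domain F. (\<lambda>s. app (F s \<rho>) a) differentiable (at \<tau>)) \<and>
        C1_on (tau_derivative F) (total_domain F)) \<and>
     (\<forall>\<rho> a. open_interval {\<tau>. a \<in> Dom (F \<tau> \<rho>)}) \<and>
     (\<forall>\<tau> \<sigma> \<rho>. \<forall>a \<in> {a \<in> Dom (F \<sigma> \<rho>). app (F \<sigma> \<rho>) a \<in> Codom (F \<sigma> \<rho>) \<inter> Codom (F \<sigma> \<tau>)}.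
        app (F \<sigma> \<rho>) a \<in> Dom (F \<tau> \<sigma>) \<and> a \<in> Dom (F \<tau> \<rho>) \<and>
        app (F \<tau> \<sigma>) (app (F \<sigma> \<rho>) a) = app (F \<tau> \<rho>) a)"
proof
  assume "\<exists>f :: 'n vector_field.
        open (Dom f) \<and> Dom f \<noteq> {} \<and> Codom f = UNIV \<and> C1_on (app f) (Dom f) \<and>
        (\<forall>\<tau> \<rho>. F \<tau> \<rho> = cauchy_transformations f \<tau> \<rho>)"
  then obtain f :: "'n vector_field" where f: "open (Dom f)" "C1_on (app f) (Dom f)"
    and ne: "Dom f \<noteq> {}" and "\<forall>\<tau> \<rho>. F \<tau> \<rho> = cauchy_transformations f \<tau> \<rho>"
    by blast
  then have F: "F = cauchy_transformations f"
    by (simp add: fun_eq_iff)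
  interpret C1_field f
    using f by unfold_locales
  show "(open (total_domain F) \<and> total_domain F \<noteq> {}) \<and>
     (\<forall>\<tau> \<rho>. is_bijection (F \<tau> \<rho>)) \<and>
     ((\<forall>(\<tau>, \<rho>, a) \<in> total_domain F. (\<lambda>s. app (F s \<rho>) a) differentiable (at \<tau>)) \<and>
        C1_on (tau_derivative F) (total_domain F)) \<and>
     (\<forall>\<rho> a. open_interval {\<tau>. a \<in> Dom (F \<tau> \<rho>)}) \<and>
     (\<forall>\<tau> \<sigma> \<rho>. \<forall>a \<in> {a \<in> Dom (F \<sigma> \<rho>). app (F \<sigma> \<rho>) a \<in> Codom (F \<sigma> \<rho>) \<inter> Codom (F \<sigma> \<tau>)}.
        app (F \<sigma> \<rho>) a \<in> Dom (F \<tau> \<sigma>) \<and> a \<in> Dom (F \<tau> \<rho>) \<and>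
        app (F \<tau> \<sigma>) (app (F \<sigma> \<rho>) a) = app (F \<tau> \<rho>) a)"
    unfolding F
  proof (intro conjI allI)
    show "\<forall>(\<tau>, \<rho>, a) \<in> total_domain CT. (\<lambda>s. app (CT s \<rho>) a) differentiable (at \<tau>)"
      using flow_vector_derivative(2) by (auto simp: total_domain_def intro: differentiableI_vector)
    show "\<forall>a \<in> {a \<in> Dom (CT \<sigma> \<rho>). app (CT \<sigma> \<rho>) a \<in> Codom (CT \<sigma> \<rho>) \<inter> Codom (CT \<sigma> \<tau>)}.
        app (CT \<sigma> \<rho>) a \<in> Dom (CT \<tau> \<sigma>) \<and> a \<in> Dom (CT \<tau> \<rho>) \<and>
        app (CT \<tau> \<sigma>) (app (CT \<sigma> \<rho>) a) = app (CT \<tau> \<rho>) a" for \<tau> \<sigma> \<rho>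
      using CT_cocycle[of _ \<sigma> \<rho> \<tau>] by simp
  qed (rule flow_regular(1) CT_total_domain_nonempty[OF ne] CT_bijection CT_tau_derivative_C1 CT_interval)+
next
  assume B: "(open (total_domain F) \<and> total_domain F \<noteq> {}) \<and>
     (\<forall>\<tau> \<rho>. is_bijection (F \<tau> \<rho>)) \<and>
     ((\<forall>(\<tau>, \<rho>, a) \<in> total_domain F. (\<lambda>s. app (F s \<rho>) a) differentiable (at \<tau>)) \<and>
        C1_on (tau_derivative F) (total_domain F)) \<and>
     (\<forall>\<rho> a. open_interval {\<tau>. a \<in> Dom (F \<tau> \<rho>)}) \<and>
     (\<forall>\<tau> \<sigma> \<rho>. \<forall>a \<in> {a \<in> Dom (F \<sigma> \<rho>). app (F \<sigma> \<rho>) a \<in> Codom (F \<sigma> \<rho>) \<inter> Codom (F \<sigma> \<tau>)}.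
        app (F \<sigma> \<rho>) a \<in> Dom (F \<tau> \<sigma>) \<and> a \<in> Dom (F \<tau> \<rho>) \<and>
        app (F \<tau> \<sigma>) (app (F \<sigma> \<rho>) a) = app (F \<tau> \<rho>) a)"
  interpret transformation_system F
  proof
    show "open (total_domain F)" "C1_on (tau_derivative F) (total_domain F)"
      using B by blast+
    show "is_bijection (F \<tau> \<rho>)" for \<tau> \<rho>
      using B by blast
    show "open_interval {\<tau>. a \<in> Dom (F \<tau> \<rho>)}" for \<rho> a
      using B by blast
    show "(\<lambda>s. app (F s \<rho>) a) differentiable (at \<tau>)" if "a \<in> Dom (F \<tau> \<rho>)" for a \<tau> \<rho>
      using B that by (auto simp: total_domain_def)
    fix a \<sigma> \<rho> \<tau> assume a: "a \<in> Dom (F \<sigma> \<rho>)" "app (F \<sigma> \<rho>) a \<in> Codom (F \<sigma> \<tau>)"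
    have "app (F \<sigma> \<rho>) a \<in> Codom (F \<sigma> \<rho>)"
      using app_extensional_funcset[of "F \<sigma> \<rho>"] a(1) by auto
    with a have "a \<in> {a \<in> Dom (F \<sigma> \<rho>). app (F \<sigma> \<rho>) a \<in> Codom (F \<sigma> \<rho>) \<inter> Codom (F \<sigma> \<tau>)}"
      by blast
    with B show "app (F \<sigma> \<rho>) a \<in> Dom (F \<tau> \<sigma>) \<and> a \<in> Dom (F \<tau> \<rho>) \<and>
        app (F \<tau> \<sigma>) (app (F \<sigma> \<rho>) a) = app (F \<tau> \<rho>) a"
      by blast
  qed
  have "total_domain F \<noteq> {}"
    using B by blast
  then obtain \<tau> \<rho> a where "a \<in> Dom (F \<tau> \<rho>)"
    by (auto simp: total_domain_def)
  from round_trip(2)[OF this] have "Dom (evolution_field F) \<noteq> {}"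
    by (auto simp: evolution_field_sel)
  then show "\<exists>f :: 'n vector_field.
        open (Dom f) \<and> Dom f \<noteq> {} \<and> Codom f = UNIV \<and> C1_on (app f) (Dom f) \<and>
        (\<forall>\<tau> \<rho>. F \<tau> \<rho> = cauchy_transformations f \<tau> \<rho>)"
    using open_Dom C1 evolution_field_sel(2) transformations_of_evolution_field
    by (intro exI[of _ "evolution_field F"]) blast
qed

end
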